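(* Let $\mathcal I=[0,b)$, $X=\{x_n\}_{n=1}^\infty$, $d_n=x_n-x_{n-1}$ with $\sup_nd_n<\infty$, and $\beta=\{\beta_n\}_{n=1}^\infty\subset\mathbb R\setminus\{0\}$ be as in the context. For the operator $\mathrm H_{X,\beta}$ to be lower semibounded it is necessary that, with some constant $C_1>0$ independent of $n$, $$\frac1{\beta_n}\ge-C_1d_n-\frac1{d_n}\qquad\text{and}\qquad\frac1{\beta_n}\ge-C_1d_{n+1}-\frac1{d_{n+1}},\qquad n\in\mathbb N,$$ and it is sufficient that, with some constant $C_2>0$ independent of $n$, $$\frac1{\beta_n}\ge-C_2\min\{d_n,d_{n+1}\},\qquad n\in\mathbb N .$$
   Context: Let $\mathcal I=[0,b)$, $0<b\le+\infty$, and $X=\{x_n\}_{n=1}^\infty$, $x_0=0$, with $0=x_0<x_1<x_2<\dots<b$ and $\lim_nx_n=b$; $d_n=x_n-x_{n-1}$; it is assumed that $d^*=\sup_nd_n<\infty$ and $\beta_n\ne0$ for all $n$. $W^{2,2}(\mathcal I\setminus X)=\{f\in L^2(\mathcal I): f,f'\in AC_{loc}(\mathcal I\setminus X),\ f''\in L^2(\mathcal I)\}$, and $W^{2,2}_{\mathrm{comp}}(\mathcal I\setminus X)$ is the set of its elements whose support is compact in $\mathcal I=[0,b)$. $\mathrm H_{X,\beta}$ is the closure in $L^2(\mathcal I)$ of the symmetric operator $-\mathrm d^2/\mathrm dx^2$ with domain $$\{f\in W^{2,2}_{\mathrm{comp}}(\mathcal I\setminus X): f'(0+)=0,\ f'(x_n+)=f'(x_n-),\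 f(x_n+)-f(x_n-)=\beta_nf'(x_n),\ n\in\mathbb N\}.$$ A symmetric operator $T$ is lower semibounded if $(Tf,f)\ge c\|f\|^2$ for all $f\in\operatorname{dom}(T)$ with some $c\in\mathbb R$. *)

theory Defs
  imports "HOL-Analysis.Analysis"
begin

(* Elements of the complex Hilbert space of square-integrable functions on S are handled through
   representatives; all notions below that concern the closed operator are invariant under changes
   on null sets. *)

definition L2 :: "real set \<Rightarrow> (real \<Rightarrow> complex) set" where
  "L2 S = {f. f \<in> borel_measurable (lebesgue_on S) \<and>
              integrable (lebesgue_on S) (\<lambda>t. (cmod (f t))\<^sup>2)}"

definition L2_inner :: "real set \<Rightarrow> (real \<Rightarrow> complex) \<Rightarrow> (real \<Rightarrow> complex) \<Rightarrow> complex" where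
  "L2_inner S f g = (LINT t|lebesgue_on S. f t * cnj (g t))"

definition L2_norm :: "real set \<Rightarrow> (real \<Rightarrow> complex) \<Rightarrow> real" where
  "L2_norm S f = sqrt (LINT t|lebesgue_on S. (cmod (f t))\<^sup>2)"

definition abs_continuous_on :: "real \<Rightarrow> real \<Rightarrow> (real \<Rightarrow> complex) \<Rightarrow> bool" where
  "abs_continuous_on p q f \<longleftrightarrow>
    (\<forall>\<epsilon>>0. \<exists>\<delta>>0. \<forall>D :: (real \<times> real) set.
       finite D \<and> (\<forall>(u,v)\<in>D. p \<le> u \<and> u \<le> v \<and> v \<le> q) \<and>
       disjoint_family_on (\<lambda>(u,v). {u<..<v}) D \<and> (\<Sum>(u,v)\<in>D. v - u) < \<delta>
       \<longrightarrow> (\<Sum>(u,v)\<in>D. cmod (f v - f u)) < \<epsilon>)"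

definition AC_loc :: "real set \<Rightarrow> (real \<Rightarrow> complex) set" where
  "AC_loc S = {f. \<forall>p q. p \<le> q \<and> {p..q} \<subseteq> S \<longrightarrow> abs_continuous_on p q f}"

(* f is an element of W^{2,2}(I - X), namely its representative that is continuously
   differentiable on I - X, with first derivative f1 and second derivative f2. If 0 is in I - X and
   is the left end point of I, the derivative at 0 is one-sided. The values of f and f1 on X are
   irrelevant. *)
definition W22 :: "real set \<Rightarrow> real set \<Rightarrow>
    (real \<Rightarrow> complex) \<Rightarrow> (real \<Rightarrow> complex) \<Rightarrow> (real \<Rightarrow> complex) \<Rightarrow> bool" where
  "W22 I X f f1 f2 \<longleftrightarrow>
     f \<in> L2 I \<and> f \<in> AC_loc (I - X) \<and>
     (\<forall>t\<in>I - X. (f has_vector_derivative f1 t) (at t within I - X)) \<and>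
     f1 \<in> AC_loc (I - X) \<and>
     (AE t in lebesgue_on I. (f1 has_vector_derivative f2 t) (at t within I - X)) \<and>
     f2 \<in> L2 I"

(* The support of the class of f; the irrelevant values of f on the discrete set X are ignored. *)
definition supp_off :: "real set \<Rightarrow> real set \<Rightarrow> (real \<Rightarrow> complex) \<Rightarrow> real set" where
  "supp_off I X f = closure {t \<in> I - X. f t \<noteq> 0}"

definition interval0 :: "ereal \<Rightarrow> real set" where
  "interval0 b = {t. 0 \<le> t \<and> ereal t < b}"

(* Operators are represented by their graphs, i.e. the sets of pairs (f, T f). The interaction
   points are x 1, x 2, ...; x 0 = 0 is only the left end point. *)

definition H_min :: "ereal \<Rightarrow> (nat \<Rightarrow> real) \<Rightarrow> (nat \<Rightarrow> real) \<Rightarrow>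
    ((real \<Rightarrow> complex) \<times> (real \<Rightarrow> complex)) set" where
  "H_min b x \<beta> = {(f, g). \<exists>f1.
     W22 (interval0 b) (x ` {1..}) f f1 (\<lambda>t. - g t) \<and>
     compact (supp_off (interval0 b) (x ` {1..}) f) \<and>
     supp_off (interval0 b) (x ` {1..}) f \<subseteq> interval0 b \<and>
     (f1 \<longlongrightarrow> 0) (at_right 0) \<and>
     (\<forall>n\<ge>1. \<exists>fplus fminus s.
        (f1 \<longlongrightarrow> s) (at_right (x n)) \<and> (f1 \<longlongrightarrow> s) (at_left (x n)) \<and>
        (f \<longlongrightarrow> fplus) (at_right (x n)) \<and> (f \<longlongrightarrow> fminus) (at_left (x n)) \<and>
        fplus - fminus = complex_of_real (\<beta> n) * s)}"

definition L2_closure :: "real set \<Rightarrow> ((real \<Rightarrow> complex) \<times> (real \<Rightarrow> complex)) set \<Rightarrow>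
    ((real \<Rightarrow> complex) \<times> (real \<Rightarrow> complex)) set" where
  "L2_closure S T = {(f, g). f \<in> L2 S \<and> g \<in> L2 S \<and>
     (\<exists>u v. (\<forall>k::nat. (u k, v k) \<in> T) \<and>
        (\<lambda>k. L2_norm S (\<lambda>t. u k t - f t)) \<longlonglongrightarrow> 0 \<and>
        (\<lambda>k. L2_norm S (\<lambda>t. v k t - g t)) \<longlonglongrightarrow> 0)}"

definition H_op :: "ereal \<Rightarrow> (nat \<Rightarrow> real) \<Rightarrow> (nat \<Rightarrow> real) \<Rightarrow>
    ((real \<Rightarrow> complex) \<times> (real \<Rightarrow> complex)) set" where
  "H_op b x \<beta> = L2_closure (interval0 b) (H_min b x \<beta>)"

(* The inequality (T f, f) >= c |f|^2 between complex numbers includes that (T f, f) is real,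
   which on a complex Hilbert space is the symmetry of T. *)
definition lower_semibounded ::
    "real set \<Rightarrow> ((real \<Rightarrow> complex) \<times> (real \<Rightarrow> complex)) set \<Rightarrow> bool" where
  "lower_semibounded S T \<longleftrightarrow>
     (\<exists>c::real. \<forall>(f, g)\<in>T. L2_inner S g f \<in> \<real> \<and> Re (L2_inner S g f) \<ge> c * (L2_norm S f)\<^sup>2)"

end

theory Submission
  imports Defs
begin

text \<open>
  Integration by parts on the gaps between the interaction points shows that, on the domain of the
  minimal operator, \<open>(Hf, f)\<close> is the sum of the integrals of \<open>|f'|\<^sup>2\<close> over the gaps and of the terms
  \<open>\<beta>\<^sub>n |f'(x\<^sub>n)|\<^sup>2 = |f(x\<^sub>n+) - f(x\<^sub>n-)|\<^sup>2 / \<beta>\<^sub>n\<close>. A lower bound for this form passes to the closure.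

  If \<open>1/\<beta>\<^sub>n \<ge> - C min(d\<^sub>n, d\<^sub>n\<^sub>+\<^sub>1)\<close>, the negative part is at most
  \<open>2 C\<close> times the sum of all \<open>d\<^sub>n (|f(x\<^sub>n-)|\<^sup>2 + |f(x\<^sub>n\<^sub>-\<^sub>1+)|\<^sup>2)\<close>, and a trace inequality on each gap bounds
  it by the Dirichlet integral plus a multiple of the squared norm.

  Conversely, evaluate the form at a function that is linear on one of the gaps adjacent to \<open>x\<^sub>n\<close>,
  vanishes at the other end of that gap, and is zero elsewhere: this yields
  \<open>1/\<beta>\<^sub>n + 1/d \<ge> - C d\<close> for the length \<open>d\<close> of that gap. Such a function lies in the form domain only.
  It is the limit, as \<open>e \<rightarrow> 0\<close>, of functions in the operator domain obtained by corrections of the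
  slope on boundary layers of width \<open>e\<close>, whose energy is of order \<open>e\<close>.
\<close>

section \<open>Absolute continuity\<close>

text \<open>Both implications are decided on the minimal operator: it is contained in its closure,
  and a lower bound extends to the closure. Compact support leaves finitely many gaps, so that no
  boundary term at \<open>b\<close> arises.

  The factor min(d_n, d_{n+1}) is what a trace inequality can afford. The bare square |f(x_n-)|^2
  costs 1/d_n times the squared norm on the gap, which blows up on short gaps; multiplied by d_n it
  costs a bounded multiple. Finiteness of sup d_n then permits one Young parameter for all gaps,
  chosen so that the Dirichlet part of the trace bound cancels against the Dirichlet integral of the
  form.

  In the converse, the jump condition dictates the slope s = jump / \<beta>_n on both sides of x_n,
  whereas a piecewise linear function has slopes of its own. The slope is therefore corrected on
  both sides of x_n. Changing a slope A by B on a layer of width e costs energy of order (|A B| +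
  B^2) e, and B stays bounded as e tends to 0 because \<beta>_n is fixed. The limit is taken for
  each n separately, so the resulting constant depends on the lower bound alone.\<close>

lemma abs_continuous_onE:
  assumes "abs_continuous_on a b F" "e > 0"
  obtains \<delta> where "\<delta> > 0" "\<And>E :: (real \<times> real) set. finite E \<Longrightarrow>
        (\<forall>(u,v)\<in>E. a \<le> u \<and> u \<le> v \<and> v \<le> b) \<Longrightarrow>
        disjoint_family_on (\<lambda>(u,v). {u<..<v}) E \<Longrightarrow> (\<Sum>(u,v)\<in>E. v - u) < \<delta> \<Longrightarrow>
        (\<Sum>(u,v)\<in>E. cmod (F v - F u)) < e"
proof -
  from assms obtain \<delta> where "\<delta> > 0" and *: "\<forall>D :: (real \<times> real) set.
       finite D \<and> (\<forall>(u,v)\<in>D. a \<le> u \<and> u \<le> v \<and> v \<le> b) \<and>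
       disjoint_family_on (\<lambda>(u,v). {u<..<v}) D \<and> (\<Sum>(u,v)\<in>D. v - u) < \<delta>
       \<longrightarrow> (\<Sum>(u,v)\<in>D. cmod (F v - F u)) < e"
    unfolding abs_continuous_on_def by blast
  show ?thesis
    by (rule that[OF \<open>\<delta> > 0\<close>]) (rule *[rule_format], intro conjI)
qed

text \<open>A direct Henstock argument: on tags in the null set \<open>N\<close> the gauge confines the intervals to an
  open set of small measure, where absolute continuity bounds the increments of \<open>F\<close>.\<close>

lemma abs_continuous_ftc:
  fixes F h :: "real \<Rightarrow> complex"
  assumes "a \<le> b" and AC: "abs_continuous_on a b F" and N: "negligible N"
    and D: "\<And>t. t \<in> {a..b} - N \<Longrightarrow> (F has_vector_derivative h t) (at t within {a..b})"
  shows "(h has_integral F b - F a) {a..b}"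
proof -
  \<comment> \<open>Setting the integrand to 0 on \<open>N\<close> does not affect the integral, and
    on tags in \<open>N\<close> it leaves only the increments of \<open>F\<close> to be
    estimated.\<close>
  define h' where "h' t = (if t \<in> N then 0 else h t)" for t
  have "(h' has_integral F b - F a) {a..b}"
    unfolding has_integral_real
  proof (intro allI impI)
    fix e :: real assume e: "e > 0"
    define e1 where "e1 = e / (2 * (b - a + 1))"
    have e1: "e1 > 0" "e1 * (b - a) < e / 2"
      using e \<open>a \<le> b\<close> by (auto simp: e1_def field_simps)
    obtain \<delta> where \<delta>: "\<delta> > 0" and AC': "\<And>E :: (real \<times> real) set. finite E \<Longrightarrow>
        (\<forall>(u,v)\<in>E. a \<le> u \<and> u \<le> v \<and> v \<le> b) \<Longrightarrow>
        disjoint_family_on (\<lambda>(u,v). {u<..<v}) E \<Longrightarrow> (\<Sum>(u,v)\<in>E. v - u) < \<delta> \<Longrightarrow>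
        (\<Sum>(u,v)\<in>E. cmod (F v - F u)) < e / 2"
      using abs_continuous_onE[OF AC, of "e / 2"] e by (metis (no_types, lifting) half_gt_zero)
    have Ns: "N \<in> null_sets lebesgue"
      using N negligible_iff_null_sets by blast
    obtain U where U: "open U" "N \<subseteq> U" "emeasure lebesgue (U - N) < ennreal \<delta>"
      using sets_lebesgue_outer_open[of N \<delta>] Ns \<delta> by blast
    have "emeasure lebesgue U < ennreal \<delta>"
      using U(3) emeasure_Diff_null_set[OF Ns, of U] U(1) by simp
    then have Um: "U \<in> lmeasurable" and Ud: "measure lebesgue U < \<delta>"
    proof -
      show "U \<in> lmeasurable"
        using U(1) \<open>emeasure lebesgue U < ennreal \<delta>\<close>
        by (intro fmeasurableI) (auto intro: less_trans[OF _ ennreal_less_top])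
      then show "measure lebesgue U < \<delta>"
        using \<open>emeasure lebesgue U < ennreal \<delta>\<close> emeasure_eq_measure2[of U lebesgue]
        by (simp add: ennreal_less_iff)
    qed
    have "\<exists>d>0. \<forall>y\<in>{a..b}. \<bar>y - t\<bar> < d \<longrightarrow> norm (F y - F t - (y - t) *\<^sub>R h t) \<le> e1 * \<bar>y - t\<bar>"
      if "t \<in> {a..b} - N" for t
      using D[OF that] e1(1) unfolding has_vector_derivative_def has_derivative_within_alt
      by (metis real_norm_def)
    then obtain d where d: "\<And>t. t \<in> {a..b} - N \<Longrightarrow> d t > 0"
      "\<And>t y. t \<in> {a..b} - N \<Longrightarrow> y \<in> {a..b} \<Longrightarrow> \<bar>y - t\<bar> < d t \<Longrightarrow>
         norm (F y - F t - (y - t) *\<^sub>R h t) \<le> e1 * \<bar>y - t\<bar>"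
      by metis
    define \<gamma> where "\<gamma> t = (if t \<in> N then U else if t \<in> {a..b} then ball t (d t) else UNIV)" for t
    show "\<exists>\<gamma>. gauge \<gamma> \<and> (\<forall>\<D>. \<D> tagged_division_of {a..b} \<and> \<gamma> fine \<D> \<longrightarrow>
        norm ((\<Sum>(x,k)\<in>\<D>. measure lborel k *\<^sub>R h' x) - (F b - F a)) < e)"
    proof (intro exI conjI allI impI)
      show "gauge \<gamma>"
        using U d(1) by (auto simp: gauge_def \<gamma>_def)
    next
      fix P assume P: "P tagged_division_of {a..b} \<and> \<gamma> fine P"
      then have tag: "P tagged_division_of {a..b}" and fine: "\<gamma> fine P" by auto
      have fin: "finite P" using tag by blast
      have ivl: "K = {Inf K..Sup K}" "Inf K \<le> x" "x \<le> Sup K" "a \<le> Inf K" "Sup K \<le> b"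
        "measure lborel K = Sup K - Inf K" if "(x, K) \<in> P" for x K
      proof -
        obtain u v where K: "K = {u..v}" using tagged_division_ofD(4)[OF tag \<open>(x, K) \<in> P\<close>] by auto
        have "x \<in> K" "K \<subseteq> {a..b}" using tag that by blast+
        with K show "K = {Inf K..Sup K}" "Inf K \<le> x" "x \<le> Sup K" "a \<le> Inf K" "Sup K \<le> b"
          "measure lborel K = Sup K - Inf K" by auto
      qed
      have disj: "{Inf K<..<Sup K} \<inter> {Inf K'<..<Sup K'} = {}"
        if "(x, K) \<in> P" "(x', K') \<in> P" "(x, K) \<noteq> (x', K')" for x K x' K'
        using tagged_division_ofD(5)[OF tag that] ivl(1)[OF that(1)] ivl(1)[OF that(2)]
        by (metis interior_atLeastAtMost_real)
      define A where "A = {(x,K) \<in> P. x \<in> N}"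
      define R where "R = {(x,K) \<in> P. x \<notin> N}"
      \<comment> \<open>Degenerate intervals are dropped because the injectivity of
        \<open>ep\<close> is derived from nonempty interiors: two different tagged intervals with
        the same end points would overlap. They carry no increment of \<open>F\<close>.\<close>
      define G where "G = {(x,K) \<in> A. Inf K < Sup K}"
      define ep where "ep = (\<lambda>(x::real, K::real set). (Inf K, Sup K))"
      have sub: "A \<subseteq> P" "R \<subseteq> P" "G \<subseteq> A" "A \<inter> R = {}" "P = A \<union> R" by (auto simp: A_def R_def G_def)
      then have fins: "finite A" "finite R" "finite G"
        using fin by (auto intro: finite_subset)
      have inj: "inj_on ep G"
      proof (rule inj_onI, clarsimp simp: ep_def)
        fix x K x' K' assume *: "(x, K) \<in> G" "(x', K') \<in> G" "Inf K = Inf K'" "Sup K = Sup K'"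
        then have "{Inf K<..<Sup K} \<noteq> {}" by (auto simp: G_def)
        then show "x = x' \<and> K = K'"
          using disj[of x K x' K'] * sub by auto
      qed
      have dj: "disjoint_family_on (\<lambda>i. {fst i<..<snd i}) (ep ` G)"
        unfolding disjoint_family_on_def
      proof (intro ballI impI)
        fix m n assume "m \<in> ep ` G" "n \<in> ep ` G" "m \<noteq> n"
        then obtain x K x' K' where G: "(x, K) \<in> G" "(x', K') \<in> G" and mn: "m = ep (x, K)" "n = ep (x', K')"
          by auto
        then have "(x, K) \<noteq> (x', K')" using \<open>m \<noteq> n\<close> by auto
        then show "{fst m<..<snd m} \<inter> {fst n<..<snd n} = {}"
          using disj[of x K x' K'] G sub by (auto simp: mn ep_def)
      qed
      have "(\<Sum>(u,v)\<in>ep ` G. v - u) = (\<Sum>(u,v)\<in>ep ` G. measure lebesgue {u<..<v})"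
        by (intro sum.cong) (auto simp: ep_def G_def)
      also have "\<dots> = measure lebesgue (\<Union>(u,v)\<in>ep ` G. {u<..<v})"
        unfolding case_prod_unfold
      proof (rule measure_finite_Union[symmetric])
        show "disjoint_family_on (\<lambda>i. {fst i<..<snd i}) (ep ` G)" by (rule dj)
      show "finite (ep ` G)" using fins by simp
      qed (auto simp: ep_def G_def)
      also have "\<dots> \<le> measure lebesgue U"
      proof (rule measure_mono_fmeasurable[OF _ _ Um])
        have "{Inf K..Sup K} \<subseteq> U" if "(x, K) \<in> G" for x K
        proof -
          have "(x,K) \<in> P" "x \<in> N" using that by (auto simp: G_def A_def)
          then show ?thesis
            using fine ivl(1) unfolding fine_def \<gamma>_def by fastforce
        qed
        then show "(\<Union>(u,v)\<in>ep ` G. {u<..<v}) \<subseteq> U"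
          by (fastforce simp: ep_def)
        show "(\<Union>(u,v)\<in>ep ` G. {u<..<v}) \<in> sets lebesgue"
          by (intro sets.finite_UN) (auto simp: fins)
      qed
      finally have len: "(\<Sum>(u,v)\<in>ep ` G. v - u) < \<delta>" using Ud by simp
      have "(\<Sum>(u,v)\<in>ep ` G. cmod (F v - F u)) < e / 2"
      proof (rule AC'[OF _ _ _ len])
        show "\<forall>(u,v)\<in>ep ` G. a \<le> u \<and> u \<le> v \<and> v \<le> b"
        proof
          fix w assume "w \<in> ep ` G"
          then obtain x K where "(x, K) \<in> P" "Inf K < Sup K" "w = (Inf K, Sup K)"
            using sub by (auto simp: ep_def G_def)
          then show "case w of (u, v) \<Rightarrow> a \<le> u \<and> u \<le> v \<and> v \<le> b"
            using ivl(4,5)[of x K] by auto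
        qed
        show "disjoint_family_on (\<lambda>(u,v). {u<..<v}) (ep ` G)"
          using dj by (simp add: case_prod_unfold)
      qed (simp add: fins)
      also have "(\<Sum>(u,v)\<in>ep ` G. cmod (F v - F u)) = (\<Sum>(x,K)\<in>G. cmod (F (Sup K) - F (Inf K)))"
        by (subst sum.reindex[OF inj]) (auto simp: ep_def case_prod_unfold)
      also have "\<dots> = (\<Sum>(x,K)\<in>A. cmod (F (Sup K) - F (Inf K)))"
      proof (rule sum.mono_neutral_left)
        show "\<forall>i\<in>A - G. (case i of (x, K) \<Rightarrow> cmod (F (Sup K) - F (Inf K))) = 0"
        proof
          fix i assume i: "i \<in> A - G"
          obtain x K where "i = (x, K)" by (cases i)
          moreover from this have "(x, K) \<in> P" "\<not> Inf K < Sup K" using i sub by (auto simp: G_def)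
          then have "Inf K = Sup K" using ivl(2,3)[of x K] by auto
          ultimately show "(case i of (x, K) \<Rightarrow> cmod (F (Sup K) - F (Inf K))) = 0" by simp
        qed
      qed (use sub fins in auto)
      finally have SA: "(\<Sum>(x,K)\<in>A. cmod (F (Sup K) - F (Inf K))) < e / 2" .
      \<comment> \<open>Straddle estimate: the tag lies between the two end points, so the errors of
        the linear approximation to the left and to the right add up to a multiple of the
        length.\<close>
      have loc: "norm (measure lborel K *\<^sub>R h' x - (F (Sup K) - F (Inf K))) \<le> e1 * (Sup K - Inf K)"
        if "(x, K) \<in> R" for x K
      proof -
        have xK: "(x, K) \<in> P" "x \<notin> N" using that by (auto simp: R_def)
        let ?u = "Inf K" and ?v = "Sup K"
        note i = ivl[OF xK(1)]
        have xab: "x \<in> {a..b} - N" using i xK by auto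
        have "K \<subseteq> ball x (d x)" using fine xK xab unfolding fine_def \<gamma>_def by fastforce
        moreover have "?u \<in> K" "?v \<in> K"
          using i(1,2,3) by (metis atLeastAtMost_iff order.trans order_refl)+
        ultimately have "\<bar>?u - x\<bar> < d x" "\<bar>?v - x\<bar> < d x"
          by (auto simp: dist_real_def subset_iff abs_minus_commute)
        then have "norm (F ?u - F x - (?u - x) *\<^sub>R h x) \<le> e1 * \<bar>?u - x\<bar>"
          "norm (F ?v - F x - (?v - x) *\<^sub>R h x) \<le> e1 * \<bar>?v - x\<bar>"
          using d(2)[OF xab, of ?u] d(2)[OF xab, of ?v] i(2-5) by auto
        moreover have "measure lborel K *\<^sub>R h' x - (F ?v - F ?u) =
          (F ?u - F x - (?u - x) *\<^sub>R h x) - (F ?v - F x - (?v - x) *\<^sub>R h x)"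
          using xK by (simp add: i(6) h'_def algebra_simps)
        ultimately have "norm (measure lborel K *\<^sub>R h' x - (F ?v - F ?u)) \<le> e1 * \<bar>?u - x\<bar> + e1 * \<bar>?v - x\<bar>"
          by (smt (verit) norm_triangle_ineq4)
        also have "\<dots> = e1 * (?v - ?u)"
          using i by (simp add: algebra_simps)
        finally show ?thesis .
      qed
      have SR: "norm (\<Sum>(x,K)\<in>R. measure lborel K *\<^sub>R h' x - (F (Sup K) - F (Inf K))) \<le> e1 * (b - a)"
      proof -
        have "norm (\<Sum>(x,K)\<in>R. measure lborel K *\<^sub>R h' x - (F (Sup K) - F (Inf K)))
            \<le> (\<Sum>(x,K)\<in>R. e1 * (Sup K - Inf K))"
          by (rule sum_norm_le) (use loc in auto)
        also have "\<dots> \<le> (\<Sum>(x,K)\<in>P. e1 * (Sup K - Inf K))"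
          proof (rule sum_mono2)
          fix i assume "i \<in> P - R"
          then show "0 \<le> (case i of (x, K) \<Rightarrow> e1 * (Sup K - Inf K))"
            using e1(1) ivl(2,3)[of "fst i" "snd i"] by (auto simp: case_prod_unfold)
        qed (use sub fin in auto)
        also have "\<dots> = e1 * (\<Sum>(x,K)\<in>P. Sup K - Inf K)"
          by (simp add: sum_distrib_left case_prod_unfold)
        also have "(\<Sum>(x,K)\<in>P. Sup K - Inf K) = b - a"
          using additive_tagged_division_1[OF \<open>a \<le> b\<close> tag, of "\<lambda>x. x"] by simp
        finally show ?thesis .
      qed
      have "(\<Sum>(x,K)\<in>P. measure lborel K *\<^sub>R h' x) - (F b - F a)
          = (\<Sum>(x,K)\<in>P. measure lborel K *\<^sub>R h' x - (F (Sup K) - F (Inf K)))"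
        using additive_tagged_division_1[OF \<open>a \<le> b\<close> tag, of F]
        by (simp add: sum_subtractf case_prod_unfold)
      also have "\<dots> = (\<Sum>(x,K)\<in>A. measure lborel K *\<^sub>R h' x - (F (Sup K) - F (Inf K)))
           + (\<Sum>(x,K)\<in>R. measure lborel K *\<^sub>R h' x - (F (Sup K) - F (Inf K)))"
        using sub fins by (simp add: sum.union_disjoint)
      finally have "norm ((\<Sum>(x,K)\<in>P. measure lborel K *\<^sub>R h' x) - (F b - F a))
        \<le> norm (\<Sum>(x,K)\<in>A. measure lborel K *\<^sub>R h' x - (F (Sup K) - F (Inf K))) + e1 * (b - a)"
        using SR by (smt (verit) norm_triangle_ineq)
      also have "norm (\<Sum>(x,K)\<in>A. measure lborel K *\<^sub>R h' x - (F (Sup K) - F (Inf K)))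
        \<le> (\<Sum>(x,K)\<in>A. cmod (F (Sup K) - F (Inf K)))"
        by (rule sum_norm_le) (auto simp: A_def h'_def norm_minus_commute)
      finally show "norm ((\<Sum>(x,K)\<in>P. measure lborel K *\<^sub>R h' x) - (F b - F a)) < e"
        using SA e1(2) by linarith
    qed
  qed
  then show ?thesis
    by (rule has_integral_spike[OF N, rotated]) (auto simp: h'_def)
qed

lemma abs_continuous_on_imp_continuous_on:
  assumes "abs_continuous_on a b F"
  shows "continuous_on {a..b} F"
  unfolding continuous_on_iff
proof (intro ballI allI impI)
  fix x e :: real assume x: "x \<in> {a..b}" and e: "0 < e"
  obtain \<delta> where \<delta>: "\<delta> > 0" and AC': "\<And>E :: (real \<times> real) set. finite E \<Longrightarrow>
        (\<forall>(u,v)\<in>E. a \<le> u \<and> u \<le> v \<and> v \<le> b) \<Longrightarrow>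
        disjoint_family_on (\<lambda>(u,v). {u<..<v}) E \<Longrightarrow> (\<Sum>(u,v)\<in>E. v - u) < \<delta> \<Longrightarrow>
        (\<Sum>(u,v)\<in>E. cmod (F v - F u)) < e"
    using abs_continuous_onE[OF assms e] by (metis (no_types, lifting))
  have "dist (F y) (F x) < e" if "y \<in> {a..b}" "dist y x < \<delta>" for y
    using AC'[of "{(min x y, max x y)}"] that x
    by (cases "x \<le> y") (auto simp: disjoint_family_on_def dist_norm norm_minus_commute)
  then show "\<exists>d>0. \<forall>x'\<in>{a..b}. dist x' x < d \<longrightarrow> dist (F x') (F x) < e"
    using \<delta> by blast
qed

lemma abs_continuous_on_lipschitz:
  assumes "\<And>u v. a \<le> u \<Longrightarrow> u \<le> v \<Longrightarrow> v \<le> b \<Longrightarrow> cmod (F v - F u) \<le> K * (v - u)"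
  shows "abs_continuous_on a b F"
  unfolding abs_continuous_on_def
proof (intro allI impI)
  fix e :: real assume e: "e > 0"
  \<comment> \<open>The bound \<open>K\<close> may be zero or negative, while the choice of
    \<open>\<delta>\<close> divides by the constant.\<close>
  define k where "k = \<bar>K\<bar> + 1"
  have k: "k > 0" by (simp add: k_def)
  show "\<exists>\<delta>>0. \<forall>D. finite D \<and> (\<forall>(u,v)\<in>D. a \<le> u \<and> u \<le> v \<and> v \<le> b) \<and>
       disjoint_family_on (\<lambda>(u,v). {u<..<v}) D \<and> (\<Sum>(u,v)\<in>D. v - u) < \<delta>
       \<longrightarrow> (\<Sum>(u,v)\<in>D. cmod (F v - F u)) < e"
  proof (intro exI conjI allI impI)
    show "e / k > 0" using e k by simp
    fix D assume D: "finite D \<and> (\<forall>(u,v)\<in>D. a \<le> u \<and> u \<le> v \<and> v \<le> b) \<and>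
       disjoint_family_on (\<lambda>(u,v). {u<..<v}) D \<and> (\<Sum>(u,v)\<in>D. v - u) < e / k"
    have "(\<Sum>(u,v)\<in>D. cmod (F v - F u)) \<le> (\<Sum>(u,v)\<in>D. k * (v - u))"
    proof (rule sum_mono, clarify)
      fix u v assume "(u,v) \<in> D"
      then have uv: "a \<le> u" "u \<le> v" "v \<le> b" using D by auto
      then have "cmod (F v - F u) \<le> K * (v - u)" by (rule assms)
      also have "\<dots> \<le> k * (v - u)" using uv by (intro mult_right_mono) (auto simp: k_def)
      finally show "cmod (F v - F u) \<le> k * (v - u)" .
    qed
    also have "\<dots> = k * (\<Sum>(u,v)\<in>D. v - u)" by (simp add: sum_distrib_left case_prod_unfold)
    also have "\<dots> < e" using D k by (simp add: field_simps)
    finally show "(\<Sum>(u,v)\<in>D. cmod (F v - F u)) < e" .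
  qed
qed

lemma abs_continuous_on_C1:
  assumes D: "\<And>t. t \<in> {a..b} \<Longrightarrow> (F has_vector_derivative F' t) (at t within {a..b})"
    and F': "continuous_on {a..b} F'"
  shows "abs_continuous_on a b F"
proof -
  have "bounded (F' ` {a..b})"
    by (intro compact_imp_bounded compact_continuous_image F') simp
  then obtain K where K: "\<And>t. t \<in> {a..b} \<Longrightarrow> norm (F' t) \<le> K"
    unfolding bounded_iff by blast
  show ?thesis
  proof (rule abs_continuous_on_lipschitz)
    fix u v assume uv: "a \<le> u" "u \<le> v" "v \<le> b"
    show "cmod (F v - F u) \<le> K * (v - u)"
      using differentiable_bound[of "{a..b}" F "\<lambda>t h. h *\<^sub>R F' t" K v u] uv D K
      unfolding has_vector_derivative_def
      by (simp add: onorm_scaleR_left onorm_id)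
  qed
qed

lemma abs_continuous_on_mult:
  assumes F: "abs_continuous_on a b F" and G: "abs_continuous_on a b G"
  shows "abs_continuous_on a b (\<lambda>t. F t * G t)"
proof -
  have "bounded (F ` {a..b})" "bounded (G ` {a..b})"
    using assms abs_continuous_on_imp_continuous_on
    by (auto intro!: compact_imp_bounded compact_continuous_image)
  then obtain K1 K2 where K12: "\<And>t. t \<in> {a..b} \<Longrightarrow> norm (F t) \<le> K1"
    "\<And>t. t \<in> {a..b} \<Longrightarrow> norm (G t) \<le> K2"
    unfolding bounded_iff by blast
  define K where "K = \<bar>K1\<bar> + \<bar>K2\<bar> + 1"
  have K: "K > 0" "\<And>t. t \<in> {a..b} \<Longrightarrow> norm (F t) \<le> K" "\<And>t. t \<in> {a..b} \<Longrightarrow> norm (G t) \<le> K"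
    using K12 unfolding K_def by (auto, (smt (verit))+)
  show ?thesis
    unfolding abs_continuous_on_def
  proof (intro allI impI)
    fix e :: real assume e: "e > 0"
    have e': "e / (2 * K) > 0" using e K by simp
    obtain \<delta>1 where \<delta>1: "\<delta>1 > 0" and 1: "\<And>E :: (real \<times> real) set. finite E \<Longrightarrow>
        (\<forall>(u,v)\<in>E. a \<le> u \<and> u \<le> v \<and> v \<le> b) \<Longrightarrow>
        disjoint_family_on (\<lambda>(u,v). {u<..<v}) E \<Longrightarrow> (\<Sum>(u,v)\<in>E. v - u) < \<delta>1 \<Longrightarrow>
        (\<Sum>(u,v)\<in>E. cmod (F v - F u)) < e / (2 * K)"
      using abs_continuous_onE[OF F e'] by (metis (no_types, lifting))
    obtain \<delta>2 where \<delta>2: "\<delta>2 > 0" and 2: "\<And>E :: (real \<times> real) set. finite E \<Longrightarrow>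
        (\<forall>(u,v)\<in>E. a \<le> u \<and> u \<le> v \<and> v \<le> b) \<Longrightarrow>
        disjoint_family_on (\<lambda>(u,v). {u<..<v}) E \<Longrightarrow> (\<Sum>(u,v)\<in>E. v - u) < \<delta>2 \<Longrightarrow>
        (\<Sum>(u,v)\<in>E. cmod (G v - G u)) < e / (2 * K)"
      using abs_continuous_onE[OF G e'] by (metis (no_types, lifting))
    show "\<exists>\<delta>>0. \<forall>D. finite D \<and> (\<forall>(u,v)\<in>D. a \<le> u \<and> u \<le> v \<and> v \<le> b) \<and>
       disjoint_family_on (\<lambda>(u,v). {u<..<v}) D \<and> (\<Sum>(u,v)\<in>D. v - u) < \<delta>
       \<longrightarrow> (\<Sum>(u,v)\<in>D. cmod (F v * G v - F u * G u)) < e"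
    proof (intro exI conjI allI impI)
      show "min \<delta>1 \<delta>2 > 0" using \<delta>1 \<delta>2 by simp
      fix D assume D: "finite D \<and> (\<forall>(u,v)\<in>D. a \<le> u \<and> u \<le> v \<and> v \<le> b) \<and>
       disjoint_family_on (\<lambda>(u,v). {u<..<v}) D \<and> (\<Sum>(u,v)\<in>D. v - u) < min \<delta>1 \<delta>2"
      have "(\<Sum>(u,v)\<in>D. cmod (F v * G v - F u * G u))
        \<le> (\<Sum>(u,v)\<in>D. K * cmod (F v - F u) + K * cmod (G v - G u))"
      proof (rule sum_mono, clarify)
        fix u v assume "(u,v) \<in> D"
        then have uv: "u \<in> {a..b}" "v \<in> {a..b}" using D by fastforce+
        have "F v * G v - F u * G u = G v * (F v - F u) + F u * (G v - G u)" by algebra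
        then have "cmod (F v * G v - F u * G u) \<le> cmod (G v) * cmod (F v - F u) + cmod (F u) * cmod (G v - G u)"
          by (metis norm_mult norm_triangle_ineq)
        also have "\<dots> \<le> K * cmod (F v - F u) + K * cmod (G v - G u)"
          using K uv by (intro add_mono mult_right_mono) auto
        finally show "cmod (F v * G v - F u * G u) \<le> K * cmod (F v - F u) + K * cmod (G v - G u)" .
      qed
      also have "\<dots> = K * (\<Sum>(u,v)\<in>D. cmod (F v - F u)) + K * (\<Sum>(u,v)\<in>D. cmod (G v - G u))"
        by (simp add: sum_distrib_left case_prod_unfold sum.distrib)
      also have "\<dots> < K * (e / (2 * K)) + K * (e / (2 * K))"
        using D K 1[of D] 2[of D] by (intro add_strict_mono mult_strict_left_mono) auto
      also have "\<dots> = e" using K by (simp add: field_simps)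
      finally show "(\<Sum>(u,v)\<in>D. cmod (F v * G v - F u * G u)) < e" .
    qed
  qed
qed

lemma abs_continuous_on_cnj:
  "abs_continuous_on a b F \<Longrightarrow> abs_continuous_on a b (\<lambda>t. cnj (F t))"
  by (simp add: abs_continuous_on_def flip: complex_cnj_diff)

text \<open>Absolute continuity inside the open interval makes \<open>F\<close> minus the indefinite
  integral of \<open>h\<close> constant there. Continuity up to the ends, which the indefinite
  integral has because \<open>h\<close> is integrable on the closed interval, carries the constant
  over to \<open>p\<close> and \<open>q\<close>.\<close>

lemma abs_continuous_ftc_interior:
  fixes F h :: "real \<Rightarrow> complex"
  assumes pq: "p < q" and cont: "continuous_on {p..q} F"
    and AC: "\<And>u v. p < u \<Longrightarrow> u \<le> v \<Longrightarrow> v < q \<Longrightarrow> abs_continuous_on u v F"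
    and N: "negligible N"
    and D: "\<And>t. t \<in> {p<..<q} - N \<Longrightarrow> (F has_vector_derivative h t) (at t)"
    and h: "h integrable_on {p..q}"
  shows "(h has_integral F q - F p) {p..q}"
proof -
  define G where "G t = F t - integral {p..t} h" for t
  have G: "G u = G v" if "p < u" "u \<le> v" "v < q" for u v
  proof -
    have "(h has_integral F v - F u) {u..v}"
      by (rule abs_continuous_ftc[OF \<open>u \<le> v\<close> AC N])
         (use that in \<open>auto intro!: has_vector_derivative_at_within D\<close>)
    moreover have "integral {p..u} h + integral {u..v} h = integral {p..v} h"
      by (rule Henstock_Kurzweil_Integration.integral_combine)
        (use that in \<open>auto intro: integrable_on_subinterval[OF h]\<close>)
    ultimately show ?thesis by (simp add: G_def integral_unique algebra_simps)
  qed
  have cG: "continuous_on (closure {p<..<q}) G"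
    unfolding G_def using pq
    by (auto intro!: continuous_on_diff cont indefinite_integral_continuous_1 h)
  have "G t = G ((p + q) / 2)" if "t \<in> {p<..<q}" for t
    using G[of t "(p + q) / 2"] G[of "(p + q) / 2" t] that by fastforce
  then have "G t = G ((p + q) / 2)" if "t \<in> closure {p<..<q}" for t
    using continuous_constant_on_closure[OF cG _ that] by blast
  from this[of p] this[of q] have "G p = G ((p + q) / 2)" "G q = G ((p + q) / 2)"
    using pq by auto
  then have "F q - integral {p..q} h = F p - integral {p..p} h"
    unfolding G_def by simp
  then have "integral {p..q} h = F q - F p"
    by (simp add: algebra_simps)
  then show ?thesis using h by (metis integrable_integral)
qed

section \<open>Square-integrable functions and closures\<close>

lemma L2_mult_cnj_integrable:
  assumes "f \<in> L2 S" "g \<in> L2 S"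
  shows "integrable (lebesgue_on S) (\<lambda>t. f t * cnj (g t))"
    and "integrable (lebesgue_on S) (\<lambda>t. cmod (f t) * cmod (g t))"
proof -
  have [measurable]: "f \<in> borel_measurable (lebesgue_on S)" "g \<in> borel_measurable (lebesgue_on S)"
    and i: "integrable (lebesgue_on S) (\<lambda>t. (cmod (f t))\<^sup>2)" "integrable (lebesgue_on S) (\<lambda>t. (cmod (g t))\<^sup>2)"
    using assms by (auto simp: L2_def)
  have b: "cmod (f t) * cmod (g t) \<le> (cmod (f t))\<^sup>2 + (cmod (g t))\<^sup>2" for t
  proof -
    have "0 \<le> cmod (f t) * cmod (g t)" by simp
    then show ?thesis using sum_squares_bound[of "cmod (f t)" "cmod (g t)"] by linarith
  qed
  have "(\<lambda>t. cnj (g t)) \<in> borel_measurable (lebesgue_on S)"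
    by (rule borel_measurable_continuous_on[of cnj]) (auto intro: continuous_intros)
  then show "integrable (lebesgue_on S) (\<lambda>t. f t * cnj (g t))"
    by (intro Bochner_Integration.integrable_bound[OF Bochner_Integration.integrable_add[OF i]])
       (use b in \<open>auto simp: norm_mult intro!: AE_I2\<close>)
  show "integrable (lebesgue_on S) (\<lambda>t. cmod (f t) * cmod (g t))"
    by (intro Bochner_Integration.integrable_bound[OF Bochner_Integration.integrable_add[OF i]])
       (use b in \<open>auto simp: norm_mult intro!: AE_I2\<close>)
qed

lemma L2_diff:
  assumes "f \<in> L2 S" "g \<in> L2 S"
  shows "(\<lambda>t. f t - g t) \<in> L2 S"
proof -
  have [measurable]: "f \<in> borel_measurable (lebesgue_on S)" "g \<in> borel_measurable (lebesgue_on S)"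
    and i: "integrable (lebesgue_on S) (\<lambda>t. (cmod (f t))\<^sup>2)" "integrable (lebesgue_on S) (\<lambda>t. (cmod (g t))\<^sup>2)"
    using assms by (auto simp: L2_def)
  have b: "(cmod (f t - g t))\<^sup>2 \<le> 2 * ((cmod (f t))\<^sup>2 + (cmod (g t))\<^sup>2)" for t
  proof -
    have "(cmod (f t - g t))\<^sup>2 \<le> (cmod (f t) + cmod (g t))\<^sup>2"
      by (intro power_mono norm_triangle_ineq4) simp
    also have "\<dots> \<le> 2 * ((cmod (f t))\<^sup>2 + (cmod (g t))\<^sup>2)"
      using sum_squares_bound[of "cmod (f t)" "cmod (g t)"] by (simp add: power2_sum)
    finally show ?thesis .
  qed
  have "integrable (lebesgue_on S) (\<lambda>t. (cmod (f t - g t))\<^sup>2)"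
    by (rule Bochner_Integration.integrable_bound[OF integrable_mult_right[OF Bochner_Integration.integrable_add[OF i], of 2]])
       (use b in \<open>auto intro!: AE_I2\<close>)
  then show ?thesis by (auto simp: L2_def)
qed

lemma L2_norm_sq: "(L2_norm S f)\<^sup>2 = (LINT t|lebesgue_on S. (cmod (f t))\<^sup>2)"
  unfolding L2_norm_def by simp

lemma L2_norm_nonneg [simp]: "0 \<le> L2_norm S f"
  unfolding L2_norm_def by simp

lemma L2_inner_self: "L2_inner S f f = complex_of_real ((L2_norm S f)\<^sup>2)"
  unfolding L2_inner_def L2_norm_sq
  by (simp only: complex_norm_square flip: integral_complex_of_real)

text \<open>Integrating Young's inequality with a free parameter \<open>l\<close> gives a family of
  bounds; if both norms are positive, their quotient is the optimal parameter and yields the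
  product.\<close>

lemma L2_cauchy_schwarz:
  assumes "f \<in> L2 S" "g \<in> L2 S"
  shows "cmod (L2_inner S f g) \<le> L2_norm S f * L2_norm S g"
proof -
  let ?a = "L2_norm S f" and ?b = "L2_norm S g"
  have i: "integrable (lebesgue_on S) (\<lambda>t. (cmod (f t))\<^sup>2)" "integrable (lebesgue_on S) (\<lambda>t. (cmod (g t))\<^sup>2)"
    using assms by (auto simp: L2_def)
  have bound: "cmod (L2_inner S f g) \<le> l * ?a\<^sup>2 / 2 + ?b\<^sup>2 / (2 * l)" if "l > 0" for l
  proof -
    have "cmod (L2_inner S f g) \<le> (LINT t|lebesgue_on S. cmod (f t * cnj (g t)))"
      unfolding L2_inner_def by (rule integral_norm_bound)
    also have "\<dots> \<le> (LINT t|lebesgue_on S. l / 2 * (cmod (f t))\<^sup>2 + 1 / (2 * l) * (cmod (g t))\<^sup>2)"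
    proof (rule integral_mono)
      fix t
      have "0 \<le> (l * cmod (f t) - cmod (g t))\<^sup>2 / (2 * l)" using that by simp
      also have "\<dots> = l / 2 * (cmod (f t))\<^sup>2 + 1 / (2 * l) * (cmod (g t))\<^sup>2 - cmod (f t) * cmod (g t)"
        using that by (simp add: power2_eq_square field_simps)
      finally show "cmod (f t * cnj (g t)) \<le> l / 2 * (cmod (f t))\<^sup>2 + 1 / (2 * l) * (cmod (g t))\<^sup>2"
        by (simp add: norm_mult)
    qed (use i L2_mult_cnj_integrable(2)[OF assms] in \<open>auto simp: norm_mult\<close>)
    also have "\<dots> = l / 2 * ?a\<^sup>2 + 1 / (2 * l) * ?b\<^sup>2"
      unfolding L2_norm_sq using i by simp
    finally show ?thesis by simp
  qed
  show ?thesis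
  proof (cases "?a = 0 \<or> ?b = 0")
    case False
    then have "?a > 0" "?b > 0" by (simp_all add: order_less_le)
    then show ?thesis using bound[of "?b / ?a"] by (simp add: field_simps power2_eq_square)
  next
    case True
    \<comment> \<open>If a norm vanishes, no optimal parameter exists. Instead \<open>l\<close> is
      taken large when the first norm is 0 and small otherwise; in the first case \<open>+ 1\<close>
      keeps it positive even if both norms vanish.\<close>
    have "cmod (L2_inner S f g) \<le> e" if "e > 0" for e
    proof (cases "?a = 0")
      case True
      have "cmod (L2_inner S f g) \<le> ?b\<^sup>2 / (2 * ((?b\<^sup>2 + 1) / (2 * e)))"
        using bound[of "(?b\<^sup>2 + 1) / (2 * e)"] True that by (simp add: add_nonneg_pos)
      also have "2 * ((?b\<^sup>2 + 1) / (2 * e)) = (?b\<^sup>2 + 1) / e"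
        using that by (simp add: field_simps)
      also have "?b\<^sup>2 / ((?b\<^sup>2 + 1) / e) = e * (?b\<^sup>2 / (?b\<^sup>2 + 1))" by simp
      also have "\<dots> \<le> e * 1" using that by (intro mult_left_mono) (auto simp: pos_divide_le_eq add_nonneg_pos)
      finally show ?thesis by simp
    next
      case False
      then have "?b = 0" using \<open>?a = 0 \<or> ?b = 0\<close> by simp
      define l where "l = 2 * (e / (?a\<^sup>2 + 1))"
      have "l > 0" using that by (simp add: l_def add_nonneg_pos)
      then have "cmod (L2_inner S f g) \<le> l * ?a\<^sup>2 / 2"
        using bound[of l] \<open>?b = 0\<close> by simp
      also have "\<dots> = (e / (?a\<^sup>2 + 1)) * ?a\<^sup>2" 
      proof -
        have "2 * (e / X) * Y / 2 = (e / X) * Y" for X Y :: real by simp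
        then show ?thesis unfolding l_def by this
      qed
      also have "\<dots> = e * (?a\<^sup>2 / (?a\<^sup>2 + 1))" by (rule times_divide_eq_left[THEN trans]) simp
      also have "\<dots> \<le> e * 1" using that by (intro mult_left_mono) (auto simp: pos_divide_le_eq add_nonneg_pos)
      finally show ?thesis by simp
    qed
    then have "cmod (L2_inner S f g) \<le> 0" by (metis field_le_epsilon add_0)
    then show ?thesis by (simp add: order_trans[OF _ mult_nonneg_nonneg])
  qed
qed

lemma L2_inner_tendsto:
  assumes f: "f \<in> L2 S" and g: "g \<in> L2 S" and u: "\<And>k. u k \<in> L2 S" and v: "\<And>k. v k \<in> L2 S"
    and lu: "(\<lambda>k::nat. L2_norm S (\<lambda>t. u k t - f t)) \<longlonglongrightarrow> 0"
    and lv: "(\<lambda>k. L2_norm S (\<lambda>t. v k t - g t)) \<longlonglongrightarrow> 0"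
  shows "(\<lambda>k. L2_inner S (v k) (u k)) \<longlonglongrightarrow> L2_inner S g f"
proof -
  let ?U = "\<lambda>k t. u k t - f t" and ?V = "\<lambda>k t. v k t - g t"
  have U: "?U k \<in> L2 S" and V: "?V k \<in> L2 S" for k using L2_diff f g u v by auto
  have eq: "L2_inner S (v k) (u k) - L2_inner S g f
      = L2_inner S (?V k) (?U k) + L2_inner S (?V k) f + L2_inner S g (?U k)" for k
  proof -
    note i = L2_mult_cnj_integrable(1)
    have *: "v k t * cnj (u k t) - g t * cnj (f t) = ?V k t * cnj (?U k t) + ?V k t * cnj (f t) + g t * cnj (?U k t)" for t
      by (simp add: algebra_simps)
    show ?thesis
      unfolding L2_inner_def
      by (subst Bochner_Integration.integral_diff[symmetric], simp_all only: *
          Bochner_Integration.integral_add Bochner_Integration.integrable_add i f g u v U V)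
  qed
  have "(\<lambda>k. L2_norm S (?V k) * L2_norm S (?U k) + L2_norm S (?V k) * L2_norm S f + L2_norm S g * L2_norm S (?U k))
      \<longlonglongrightarrow> 0 * 0 + 0 * L2_norm S f + L2_norm S g * 0"
    by (intro tendsto_intros lu lv)
  then have lim: "(\<lambda>k. L2_norm S (?V k) * L2_norm S (?U k) + L2_norm S (?V k) * L2_norm S f + L2_norm S g * L2_norm S (?U k)) \<longlonglongrightarrow> 0"
    by simp
  have "(\<lambda>k. L2_inner S (v k) (u k) - L2_inner S g f) \<longlonglongrightarrow> 0"
  proof (rule Lim_null_comparison[OF _ lim], intro always_eventually allI)
    fix k
    show "norm (L2_inner S (v k) (u k) - L2_inner S g f)
        \<le> L2_norm S (?V k) * L2_norm S (?U k) + L2_norm S (?V k) * L2_norm S f + L2_norm S g * L2_norm S (?U k)"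
      unfolding eq
      by (intro order_trans[OF norm_triangle_ineq] add_mono L2_cauchy_schwarz U V f g)
  qed
  then show ?thesis by (simp add: Lim_null[symmetric])
qed

text \<open>Convergence in the graph makes the inner products and the squared norms converge, so the
  inequality survives the limit. Symmetry survives too, since the reals are closed in the complex
  plane.\<close>

lemma lower_semibounded_closure:
  assumes T: "T \<subseteq> L2 S \<times> L2 S" and sb: "lower_semibounded S T"
  shows "lower_semibounded S (L2_closure S T)"
proof -
  obtain c :: real where c: "\<And>f g. (f, g) \<in> T \<Longrightarrow> L2_inner S g f \<in> \<real> \<and> Re (L2_inner S g f) \<ge> c * (L2_norm S f)\<^sup>2"
    using sb unfolding lower_semibounded_def by blast
  have "L2_inner S g f \<in> \<real> \<and> Re (L2_inner S g f) \<ge> c * (L2_norm S f)\<^sup>2" if "(f, g) \<in> L2_closure S T" for f g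
  proof -
    obtain u v where f: "f \<in> L2 S" and g: "g \<in> L2 S" and uv: "\<And>k::nat. (u k, v k) \<in> T"
      and lu: "(\<lambda>k. L2_norm S (\<lambda>t. u k t - f t)) \<longlonglongrightarrow> 0"
      and lv: "(\<lambda>k. L2_norm S (\<lambda>t. v k t - g t)) \<longlonglongrightarrow> 0"
      using \<open>(f, g) \<in> L2_closure S T\<close> unfolding L2_closure_def by blast
    have u: "\<And>k. u k \<in> L2 S" and v: "\<And>k. v k \<in> L2 S" using T uv by auto
    have l1: "(\<lambda>k. L2_inner S (v k) (u k)) \<longlonglongrightarrow> L2_inner S g f"
      by (rule L2_inner_tendsto[OF f g u v lu lv])
    have "(\<lambda>k. L2_inner S (u k) (u k)) \<longlonglongrightarrow> L2_inner S f f"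
      by (rule L2_inner_tendsto[OF f f u u lu lu])
    then have "(\<lambda>k. Re (L2_inner S (u k) (u k))) \<longlonglongrightarrow> Re (L2_inner S f f)"
      by (rule tendsto_Re)
    then have l2: "(\<lambda>k. (L2_norm S (u k))\<^sup>2) \<longlonglongrightarrow> (L2_norm S f)\<^sup>2"
      by (simp add: L2_inner_self)
    have "L2_inner S g f \<in> \<real>"
      by (rule closed_sequentially[OF closed_complex_Reals _ l1]) (use c uv in blast)
    moreover have "c * (L2_norm S f)\<^sup>2 \<le> Re (L2_inner S g f)"
      by (rule LIMSEQ_le[OF tendsto_mult_left[OF l2] tendsto_Re[OF l1]]) (use c uv in blast)
    ultimately show ?thesis by blast
  qed
  then show ?thesis unfolding lower_semibounded_def by blast
qed

lemma subset_L2_closure: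
  assumes "T \<subseteq> L2 S \<times> L2 S"
  shows "T \<subseteq> L2_closure S T"
proof
  fix fg assume fg: "fg \<in> T"
  obtain f g where [simp]: "fg = (f, g)" by (cases fg)
  have "L2_norm S (\<lambda>t. f t - f t) = 0" "L2_norm S (\<lambda>t. g t - g t) = 0"
    by (simp_all add: L2_norm_def)
  then show "fg \<in> L2_closure S T"
    unfolding L2_closure_def
  proof (clarsimp, intro conjI)
    show "\<exists>u v. (\<forall>k. (u k, v k) \<in> T) \<and> (\<lambda>k. L2_norm S (\<lambda>t. u k t - f t)) \<longlonglongrightarrow> 0 \<and>
        (\<lambda>k. L2_norm S (\<lambda>t. v k t - g t)) \<longlonglongrightarrow> 0"
      using fg by (intro exI[of _ "\<lambda>_::nat. f"] exI[of _ "\<lambda>_::nat. g"]) (simp add: L2_norm_def)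
  qed (use fg assms in auto)
qed

section \<open>Green's formula and traces on one gap\<close>

text \<open>Values at interaction points are arbitrary. Overwriting them by one-sided limits
  produces a function continuous on the closed gap, while all integrals stay the same.\<close>

definition extend_Icc :: "real \<Rightarrow> real \<Rightarrow> 'a \<Rightarrow> 'a \<Rightarrow> (real \<Rightarrow> 'a) \<Rightarrow> real \<Rightarrow> 'a" where
  "extend_Icc p q l r f t = (if t \<le> p then l else if q \<le> t then r else f t)"

lemma extend_Icc_simps [simp]:
  "extend_Icc p q l r f p = l"
  "p < q \<Longrightarrow> extend_Icc p q l r f q = r"
  "p < t \<Longrightarrow> t < q \<Longrightarrow> extend_Icc p q l r f t = f t"
  by (auto simp: extend_Icc_def)

lemma continuous_on_extend_Icc:
  fixes f :: "real \<Rightarrow> 'a::topological_space"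
  assumes pq: "p < q" and c: "continuous_on {p<..<q} f"
    and l: "(f \<longlongrightarrow> l) (at_right p)" and r: "(f \<longlongrightarrow> r) (at_left q)"
  shows "continuous_on {p..q} (extend_Icc p q l r f)"
proof (rule continuous_on_IccI[OF _ _ _ pq])
  have "\<forall>\<^sub>F t in at_right p. f t = extend_Icc p q l r f t"
    using eventually_at_right_less[of p] eventually_at_right_real[OF pq]
    by eventually_elim auto
  then show "(extend_Icc p q l r f \<longlongrightarrow> extend_Icc p q l r f p) (at_right p)"
    using l by (simp add: filterlim_cong[OF refl refl])
  have "\<forall>\<^sub>F t in at_left q. f t = extend_Icc p q l r f t"
    using eventually_at_left_real[OF pq]
    by eventually_elim auto
  then show "(extend_Icc p q l r f \<longlongrightarrow> extend_Icc p q l r f q) (at_left q)"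
    using r pq by (simp add: filterlim_cong[OF refl refl])
  fix x assume x: "p < x" "x < q"
  then have "(f \<longlongrightarrow> f x) (at x)"
    using c by (simp add: continuous_on_eq_continuous_at continuous_at)
  moreover have "\<forall>\<^sub>F t in at x. f t = extend_Icc p q l r f t"
    unfolding eventually_at_topological
    by (rule exI[of _ "{p<..<q}"]) (use x in auto)
  ultimately show "extend_Icc p q l r f \<midarrow>x\<rightarrow> extend_Icc p q l r f x"
    using x by (simp add: filterlim_cong[OF refl refl])
qed

lemma integrable_on_extend_Icc:
  assumes "p < q" "(\<lambda>t. H (extend_Icc p q l r f t)) integrable_on {p..q}"
  shows "(\<lambda>t. H (f t)) integrable_on {p..q}"
proof (rule integrable_spike[OF assms(2)])
  show "negligible {p, q}" by simp
qed auto

lemma abs_continuous_on_cong: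
  assumes "\<And>t. t \<in> {a..b} \<Longrightarrow> F t = G t"
  shows "abs_continuous_on a b F = abs_continuous_on a b G"
proof -
  have "(\<Sum>(u,v)\<in>E. cmod (F v - F u)) = (\<Sum>(u,v)\<in>E. cmod (G v - G u))"
    if "\<forall>(u,v)\<in>E. a \<le> u \<and> u \<le> v \<and> v \<le> b" for E
    by (rule sum.cong) (use that assms in fastforce)+
  then show ?thesis unfolding abs_continuous_on_def by (metis (no_types, lifting))
qed

text \<open>A function on a gap between two interaction points. The one-sided limits allow integrating up
  to the end points although absolute continuity of \<open>f1\<close> is known only on compact subintervals of
  the open gap.\<close>

locale regular_interval =
  fixes p q :: real and f f1 g :: "real \<Rightarrow> complex" and fp fq sp sq :: complex and N :: "real set"
  assumes pq: "p < q"
    and D: "\<And>t. p < t \<Longrightarrow> t < q \<Longrightarrow> (f has_vector_derivative f1 t) (at t)"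
    and AC: "\<And>u v. p < u \<Longrightarrow> u \<le> v \<Longrightarrow> v < q \<Longrightarrow> abs_continuous_on u v f1"
    and N: "negligible N"
    and D1: "\<And>t. t \<in> {p<..<q} - N \<Longrightarrow> (f1 has_vector_derivative - g t) (at t)"
    and fp: "(f \<longlongrightarrow> fp) (at_right p)" and fq: "(f \<longlongrightarrow> fq) (at_left q)"
    and sp: "(f1 \<longlongrightarrow> sp) (at_right p)" and sq: "(f1 \<longlongrightarrow> sq) (at_left q)"
begin

lemma continuous_f: "continuous_on {p<..<q} f"
  using D by (auto intro!: continuous_at_imp_continuous_on has_vector_derivative_continuous)

lemma continuous_f1: "continuous_on {p<..<q} f1"
proof (rule continuous_at_imp_continuous_on, rule ballI)
  fix t assume t: "t \<in> {p<..<q}"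
  define u v where "u = (p + t) / 2" and "v = (t + q) / 2"
  have "continuous_on {u..v} f1"
    using t by (intro abs_continuous_on_imp_continuous_on AC) (auto simp: u_def v_def)
  moreover have "t \<in> interior {u..v}" using t by (auto simp: u_def v_def)
  ultimately show "isCont f1 t" using continuous_on_interior by blast
qed

abbreviation "F \<equiv> extend_Icc p q fp fq f"
abbreviation "F1 \<equiv> extend_Icc p q sp sq f1"

lemma continuous_F: "continuous_on {p..q} F"
  by (rule continuous_on_extend_Icc[OF pq continuous_f fp fq])

lemma continuous_F1: "continuous_on {p..q} F1"
  by (rule continuous_on_extend_Icc[OF pq continuous_f1 sp sq])

lemma F_has_vector_derivative:
  assumes "p < t" "t < q" shows "(F has_vector_derivative F1 t) (at t)"
  using has_vector_derivative_transform_within_open[OF D[OF assms], of "{p<..<q}" F] assms by simp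

lemma integrable_sq: "(\<lambda>t. (cmod (f t))\<^sup>2) integrable_on {p..q}" "(\<lambda>t. (cmod (f1 t))\<^sup>2) integrable_on {p..q}"
proof -
  have "(\<lambda>t. (cmod (F t))\<^sup>2) integrable_on {p..q}" "(\<lambda>t. (cmod (F1 t))\<^sup>2) integrable_on {p..q}"
    by (intro integrable_continuous_interval continuous_intros continuous_F continuous_F1)+
  from this(1) show "(\<lambda>t. (cmod (f t))\<^sup>2) integrable_on {p..q}"
    by (rule integrable_on_extend_Icc[OF pq, where H = "\<lambda>x. (cmod x)\<^sup>2"])
  from \<open>(\<lambda>t. (cmod (F1 t))\<^sup>2) integrable_on {p..q}\<close> show "(\<lambda>t. (cmod (f1 t))\<^sup>2) integrable_on {p..q}"
    by (rule integrable_on_extend_Icc[OF pq, where H = "\<lambda>x. (cmod x)\<^sup>2"])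
qed

text \<open>The product \<open>F1 * cnj F\<close> is continuous up to the ends, absolutely
  continuous inside as a product of \<open>f1\<close> with a C1 function, and has almost everywhere
  the derivative |f1|^2 - g cnj(f), the sign coming from f1' = -g.\<close>

lemma green:
  assumes int: "(\<lambda>t. g t * cnj (f t)) integrable_on {p..q}"
  shows "integral {p..q} (\<lambda>t. g t * cnj (f t)) =
    complex_of_real (integral {p..q} (\<lambda>t. (cmod (f1 t))\<^sup>2)) - sq * cnj fq + sp * cnj fp"
proof -
  let ?h = "\<lambda>t. complex_of_real ((cmod (f1 t))\<^sup>2) - g t * cnj (f t)"
  have "(\<lambda>t. complex_of_real ((cmod (f1 t))\<^sup>2)) integrable_on {p..q}"
    using integrable_linear[OF integrable_sq(2) bounded_linear_of_real] by (simp add: o_def)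
  then have hint: "?h integrable_on {p..q}" by (intro integrable_diff int)
  have "(?h has_integral F1 q * cnj (F q) - F1 p * cnj (F p)) {p..q}"
  proof (rule abs_continuous_ftc_interior[OF pq _ _ N _ hint])
    show "continuous_on {p..q} (\<lambda>t. F1 t * cnj (F t))"
      by (intro continuous_intros continuous_F continuous_F1)
    fix u v assume uv: "p < u" "u \<le> v" "v < q"
    have "abs_continuous_on u v f"
    proof (rule abs_continuous_on_C1)
      show "(f has_vector_derivative f1 t) (at t within {u..v})" if "t \<in> {u..v}" for t
        using that uv by (intro has_vector_derivative_at_within[OF D]) auto
      show "continuous_on {u..v} f1"
        by (rule continuous_on_subset[OF continuous_f1]) (use uv in auto)
    qed
    then have "abs_continuous_on u v (\<lambda>t. f1 t * cnj (f t))"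
      by (intro abs_continuous_on_mult abs_continuous_on_cnj AC uv)
    moreover have "abs_continuous_on u v (\<lambda>t. F1 t * cnj (F t)) = abs_continuous_on u v (\<lambda>t. f1 t * cnj (f t))"
      by (rule abs_continuous_on_cong) (use uv in auto)
    ultimately show "abs_continuous_on u v (\<lambda>t. F1 t * cnj (F t))" by simp
  next
    fix t assume t: "t \<in> {p<..<q} - N"
    have "((\<lambda>t. f1 t * cnj (f t)) has_vector_derivative (f1 t * cnj (f1 t) + (- g t) * cnj (f t))) (at t)"
      using t by (intro has_vector_derivative_mult has_vector_derivative_cnj D D1) auto
    then have "((\<lambda>t. f1 t * cnj (f t)) has_vector_derivative ?h t) (at t)"
      by (simp only: complex_norm_square diff_conv_add_uminus mult_minus_left)
    then show "((\<lambda>t. F1 t * cnj (F t)) has_vector_derivative ?h t) (at t)"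
      by (rule has_vector_derivative_transform_within_open[of _ _ _ "{p<..<q}"]) (use t in auto)
  qed
  then have "integral {p..q} ?h = sq * cnj fq - sp * cnj fp"
    using pq by (simp add: integral_unique)
  moreover have "integral {p..q} ?h = complex_of_real (integral {p..q} (\<lambda>t. (cmod (f1 t))\<^sup>2)) - integral {p..q} (\<lambda>t. g t * cnj (f t))"
  proof -
    have "integral {p..q} (\<lambda>t. complex_of_real ((cmod (f1 t))\<^sup>2)) = complex_of_real (integral {p..q} (\<lambda>t. (cmod (f1 t))\<^sup>2))"
      using integral_linear[OF integrable_sq(2) bounded_linear_of_real] by (simp add: o_def)
    then show ?thesis
      using \<open>(\<lambda>t. complex_of_real ((cmod (f1 t))\<^sup>2)) integrable_on {p..q}\<close> int
      by (simp add: Henstock_Kurzweil_Integration.integral_diff)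
  qed
  ultimately show ?thesis by algebra
qed

text \<open>Integrating the derivative of \<open>(t - c) |f|\<^sup>2\<close>, where \<open>c\<close> is the opposite end point, gives a trace
  estimate that carries the factor \<open>q - p\<close>.\<close>

lemma weighted_trace:
  assumes \<eta>: "\<eta> > 0" and c: "c \<in> {p..q}"
  shows "(q - c) * (cmod fq)\<^sup>2 - (p - c) * (cmod fp)\<^sup>2 \<le>
     (1 + (q - p) / \<eta>) * integral {p..q} (\<lambda>t. (cmod (f t))\<^sup>2) +
     (q - p) * \<eta> * integral {p..q} (\<lambda>t. (cmod (f1 t))\<^sup>2)"
proof -
  let ?G = "\<lambda>t. (t - c) * (cmod (F t))\<^sup>2"
  let ?G' = "\<lambda>t. (cmod (F t))\<^sup>2 + (t - c) * (2 * (F t \<bullet> F1 t))"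
  have ftc: "(?G' has_integral ?G q - ?G p) {p..q}"
  proof (rule fundamental_theorem_of_calculus_interior)
    show "continuous_on {p..q} ?G"
      by (intro continuous_intros continuous_F)
    fix t assume "t \<in> {p<..<q}"
    then have "(F has_vector_derivative F1 t) (at t)" using F_has_vector_derivative by auto
    then have Ft: "(F has_derivative (\<lambda>h. h *\<^sub>R F1 t)) (at t)" by (simp add: has_vector_derivative_def)
    have "((\<lambda>t. F t \<bullet> F t) has_vector_derivative F t \<bullet> F1 t + F1 t \<bullet> F t) (at t)"
      unfolding has_vector_derivative_def
      by (rule has_derivative_eq_rhs[OF has_derivative_inner[OF Ft Ft]]) (auto simp: algebra_simps fun_eq_iff)
    then have "((\<lambda>t. (cmod (F t))\<^sup>2) has_vector_derivative 2 * (F t \<bullet> F1 t)) (at t)"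
      by (simp add: power2_norm_eq_inner inner_commute)
    then have "((\<lambda>t. (cmod (F t))\<^sup>2) has_real_derivative 2 * (F t \<bullet> F1 t)) (at t)"
      by (simp add: has_real_derivative_iff_has_vector_derivative)
    from DERIV_mult[OF DERIV_diff[OF DERIV_ident DERIV_const[of c]] this]
    have "(?G has_real_derivative ?G' t) (at t)"
      by (simp add: algebra_simps)
    then show "(?G has_vector_derivative ?G' t) (at t)"
      by (simp add: has_real_derivative_iff_has_vector_derivative)
  qed (use pq in auto)
  \<comment> \<open>Young's inequality for the cross term, with |t - c| at most
    \<open>q - p\<close>. The parameter \<open>\<eta>\<close> stays free so that the coefficient of
    the Dirichlet integral can later be made as small as required.\<close>
  let ?R = "\<lambda>t. (1 + (q - p) / \<eta>) * (cmod (F t))\<^sup>2 + (q - p) * \<eta> * (cmod (F1 t))\<^sup>2"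
  have Rint: "?R integrable_on {p..q}"
    by (intro integrable_continuous_interval continuous_intros continuous_F continuous_F1)
  have "?G q - ?G p \<le> integral {p..q} ?R"
  proof (rule has_integral_le[OF ftc integrable_integral[OF Rint]])
    fix t assume t: "t \<in> {p..q}"
    let ?a = "cmod (F t)" and ?b = "cmod (F1 t)"
    have "2 * (?a * ?b) \<le> ?a\<^sup>2 / \<eta> + \<eta> * ?b\<^sup>2"
    proof -
      have "0 \<le> (?a - \<eta> * ?b)\<^sup>2 / \<eta>" using \<eta> by simp
      also have "\<dots> = ?a\<^sup>2 / \<eta> + \<eta> * ?b\<^sup>2 - 2 * (?a * ?b)"
        using \<eta> by (simp add: power2_eq_square field_simps)
      finally show ?thesis by simp
    qed
    moreover have "\<bar>F t \<bullet> F1 t\<bar> \<le> ?a * ?b" by (rule Cauchy_Schwarz_ineq2)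
    ultimately have "\<bar>2 * (F t \<bullet> F1 t)\<bar> \<le> ?a\<^sup>2 / \<eta> + \<eta> * ?b\<^sup>2" by simp
    moreover have "\<bar>t - c\<bar> \<le> q - p" using t c by auto
    ultimately have "\<bar>t - c\<bar> * \<bar>2 * (F t \<bullet> F1 t)\<bar> \<le> (q - p) * (?a\<^sup>2 / \<eta> + \<eta> * ?b\<^sup>2)"
      using pq by (intro mult_mono) auto
    then have "(t - c) * (2 * (F t \<bullet> F1 t)) \<le> (q - p) * (?a\<^sup>2 / \<eta> + \<eta> * ?b\<^sup>2)"
      by (metis abs_mult abs_le_D1)
    then show "?G' t \<le> ?R t" by (simp add: algebra_simps)
  qed
  also have "integral {p..q} ?R = integral {p..q} (\<lambda>t. (1 + (q - p) / \<eta>) * (cmod (f t))\<^sup>2 + (q - p) * \<eta> * (cmod (f1 t))\<^sup>2)"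
    by (rule integral_spike[of "{p, q}"]) auto
  also have "\<dots> = (1 + (q - p) / \<eta>) * integral {p..q} (\<lambda>t. (cmod (f t))\<^sup>2) +
     (q - p) * \<eta> * integral {p..q} (\<lambda>t. (cmod (f1 t))\<^sup>2)"
    by (subst Henstock_Kurzweil_Integration.integral_add)
      (auto intro!: integrable_on_mult_right integrable_sq)
  finally show ?thesis using pq by simp
qed

lemma trace_right:
  assumes "\<eta> > 0"
  shows "(q - p) * (cmod fq)\<^sup>2 \<le>
     (1 + (q - p) / \<eta>) * integral {p..q} (\<lambda>t. (cmod (f t))\<^sup>2) +
     (q - p) * \<eta> * integral {p..q} (\<lambda>t. (cmod (f1 t))\<^sup>2)"
  using weighted_trace[OF assms, of p] pq by simp

lemma trace_left:
  assumes "\<eta> > 0"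
  shows "(q - p) * (cmod fp)\<^sup>2 \<le>
     (1 + (q - p) / \<eta>) * integral {p..q} (\<lambda>t. (cmod (f t))\<^sup>2) +
     (q - p) * \<eta> * integral {p..q} (\<lambda>t. (cmod (f1 t))\<^sup>2)"
  using weighted_trace[OF assms, of q] pq by (simp add: left_diff_distrib)

end

section \<open>The quadratic form\<close>

lemma L2_mult_cnj_integrable_on:
  assumes "f \<in> L2 S" "g \<in> L2 S" "S \<in> sets lebesgue"
  shows "(\<lambda>t. f t * cnj (g t)) integrable_on S"
    and "L2_inner S f g = integral S (\<lambda>t. f t * cnj (g t))"
  using assms unfolding L2_inner_def
  by (auto intro!: integrable_on_lebesgue_on lebesgue_integral_eq_integral L2_mult_cnj_integrable)

lemma L2_norm_sq_integral:
  assumes "f \<in> L2 S" "S \<in> sets lebesgue"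
  shows "(\<lambda>t. (cmod (f t))\<^sup>2) integrable_on S"
    and "(L2_norm S f)\<^sup>2 = integral S (\<lambda>t. (cmod (f t))\<^sup>2)"
  using assms unfolding L2_norm_sq
  by (auto intro!: integrable_on_lebesgue_on lebesgue_integral_eq_integral simp: L2_def)

lemma interval0_lebesgue: "interval0 b \<in> sets lebesgue"
proof -
  have "interval0 b = {0..} \<inter> {t. ereal t < b}" by (auto simp: interval0_def)
  moreover have "open {t. ereal t < b}"
    by (cases b) (auto simp flip: lessThan_def)
  ultimately show ?thesis by (simp add: sets.Int borel_open)
qed

locale interaction_points =
  fixes b :: ereal and x \<beta> :: "nat \<Rightarrow> real"
  assumes x0: "x 0 = 0" and mono: "strict_mono x" and less_b: "\<And>n. ereal (x n) < b"
    and lim: "(\<lambda>n. ereal (x n)) \<longlonglongrightarrow> b"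
begin

abbreviation "I \<equiv> interval0 b"
abbreviation "X \<equiv> x ` {1..}"

lemma x_less [simp]: "x m < x n \<longleftrightarrow> m < n" and x_le [simp]: "x m \<le> x n \<longleftrightarrow> m \<le> n"
  using mono by (simp_all add: strict_mono_less strict_mono_less_eq)

lemma x_nonneg [simp]: "0 \<le> x n"
  using x_le[of 0 n] x0 by simp

lemma Icc_subset: "{x m..x n} \<subseteq> I"
proof
  fix t assume "t \<in> {x m..x n}"
  then have "0 \<le> t" "ereal t \<le> ereal (x n)" using x_nonneg[of m] by (auto simp del: x_nonneg)
  then show "t \<in> I"
    using le_less_trans[OF _ less_b[of n], of "ereal t"] by (auto simp: interval0_def)
qed

lemma gap_subset: "{x n<..<x (Suc n)} \<subseteq> I - X"
proof
  fix t assume t: "t \<in> {x n<..<x (Suc n)}"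
  have "t \<notin> X"
  proof
    assume "t \<in> X"
    then obtain k where "t = x k" by auto
    then show False using t by auto
  qed
  then show "t \<in> I - X" using t Icc_subset[of n "Suc n"] by auto
qed

lemma at_within_gap: "t \<in> {x n<..<x (Suc n)} \<Longrightarrow> at t within I - X = at t"
  by (rule at_within_open_subset[OF _ _ gap_subset]) auto

lemma negligible_X: "negligible X"
  unfolding negligible_iff_null_sets
  by (intro null_sets_completionI countable_imp_null_set_lborel countable_image) auto

text \<open>A compact subset of the half-open interval stays away from \<open>b\<close>, and the
  interaction points accumulate only at \<open>b\<close>. This is how compact support becomes a
  finite number of gaps.\<close>

lemma eventually_above:
  assumes "compact S" "S \<subseteq> I"
  obtains M where "\<And>t. t \<in> S \<Longrightarrow> t \<le> x M"
proof (cases "S = {}")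
  case False
  obtain r where r: "r \<in> S" "\<And>t. t \<in> S \<Longrightarrow> t \<le> r"
    using compact_attains_sup[OF assms(1) False] by blast
  then have "ereal r < b" using assms(2) by (auto simp: interval0_def)
  then have "\<forall>\<^sub>F n in sequentially. ereal r < ereal (x n)"
    using order_tendstoD(1)[OF lim] by blast
  then obtain M where "r < x M" by (auto simp: eventually_sequentially)
  then show ?thesis using that[of M] r by force
qed (use that in auto)

lemma integral_sum_gaps:
  fixes h :: "real \<Rightarrow> 'a::euclidean_space"
  assumes h: "h integrable_on I" and z: "\<And>t. t \<in> I - X \<Longrightarrow> x M < t \<Longrightarrow> h t = 0"
  shows "integral I h = (\<Sum>n<M. integral {x n..x (Suc n)} h)"
proof -
  \<comment> \<open>Vanishing beyond \<open>x M\<close> is known only off the interaction points,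
    which form a null set.\<close>
  have "integral I h = integral I (\<lambda>t. if t \<in> {x 0..x M} then h t else 0)"
    by (rule integral_spike[OF negligible_X]) (use z x0 in \<open>auto simp: interval0_def\<close>)
  also have "\<dots> = integral {x 0..x M} h"
    using Icc_subset[of 0 M] by (simp only: integral_restrict_Int Int_absorb2)
  also have "\<dots> = (\<Sum>n<m. integral {x n..x (Suc n)} h)" if "m = M" for m
    unfolding that[symmetric]
  proof (induction m)
    case (Suc m)
    have "integral {x 0..x m} h + integral {x m..x (Suc m)} h = integral {x 0..x (Suc m)} h"
      by (rule Henstock_Kurzweil_Integration.integral_combine)
         (auto intro!: integrable_on_subinterval[OF h] Icc_subset)
    then show ?case using Suc by simp
  qed simp
  finally show ?thesis by simp
qed

text \<open>Here \<open>fp n\<close>, \<open>fm n\<close> and \<open>s n\<close> are \<open>f(x\<^sub>n+)\<close>, \<open>f(x\<^sub>n-)\<close> and \<open>f'(x\<^sub>n)\<close>. For \<open>n = 0\<close> only the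
  right limits matter, and \<open>s 0 = 0\<close> is the Neumann condition at 0.\<close>

definition boundary_data ::
  "(real \<Rightarrow> complex) \<Rightarrow> (real \<Rightarrow> complex) \<Rightarrow> (real \<Rightarrow> complex) \<Rightarrow>
   (nat \<Rightarrow> complex) \<Rightarrow> (nat \<Rightarrow> complex) \<Rightarrow> (nat \<Rightarrow> complex) \<Rightarrow> nat \<Rightarrow> bool" where
  "boundary_data f f1 g fp fm s M \<longleftrightarrow>
     W22 I X f f1 (\<lambda>t. - g t) \<and> (\<forall>t\<in>I - X. x M < t \<longrightarrow> f t = 0) \<and> s 0 = 0 \<and>
     (\<forall>n. (f \<longlongrightarrow> fp n) (at_right (x n)) \<and> (f1 \<longlongrightarrow> s n) (at_right (x n))) \<and>
     (\<forall>n\<ge>1. (f \<longlongrightarrow> fm n) (at_left (x n)) \<and> (f1 \<longlongrightarrow> s n) (at_left (x n)) \<and>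
        fp n - fm n = complex_of_real (\<beta> n) * s n)"

lemma H_min_boundary_data:
  assumes "(f, g) \<in> H_min b x \<beta>"
  obtains f1 fp fm s M where "boundary_data f f1 g fp fm s M"
proof -
  obtain f1 where W: "W22 I X f f1 (\<lambda>t. - g t)" and co: "compact (supp_off I X f)" "supp_off I X f \<subseteq> I"
    and f10: "(f1 \<longlongrightarrow> 0) (at_right 0)"
    and *: "\<forall>n\<ge>1. \<exists>fplus fminus s.
        (f1 \<longlongrightarrow> s) (at_right (x n)) \<and> (f1 \<longlongrightarrow> s) (at_left (x n)) \<and>
        (f \<longlongrightarrow> fplus) (at_right (x n)) \<and> (f \<longlongrightarrow> fminus) (at_left (x n)) \<and>
        fplus - fminus = complex_of_real (\<beta> n) * s"
    using assms unfolding H_min_def by auto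
  obtain M where M: "\<And>t. t \<in> supp_off I X f \<Longrightarrow> t \<le> x M"
    using eventually_above[OF co] by blast
  obtain fp fm s where lims: "\<And>n. n \<ge> 1 \<Longrightarrow> (f1 \<longlongrightarrow> s n) (at_right (x n)) \<and> (f1 \<longlongrightarrow> s n) (at_left (x n)) \<and>
        (f \<longlongrightarrow> fp n) (at_right (x n)) \<and> (f \<longlongrightarrow> fm n) (at_left (x n)) \<and>
        fp n - fm n = complex_of_real (\<beta> n) * s n"
  proof -
    from * have "\<forall>n. \<exists>r. n \<ge> 1 \<longrightarrow> (f1 \<longlongrightarrow> snd (snd r)) (at_right (x n)) \<and> (f1 \<longlongrightarrow> snd (snd r)) (at_left (x n)) \<and>
        (f \<longlongrightarrow> fst r) (at_right (x n)) \<and> (f \<longlongrightarrow> fst (snd r)) (at_left (x n)) \<and>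
        fst r - fst (snd r) = complex_of_real (\<beta> n) * snd (snd r)"
      by (metis fst_conv snd_conv)
    from choice[OF this] obtain r where "\<forall>n. n \<ge> 1 \<longrightarrow> (f1 \<longlongrightarrow> snd (snd (r n))) (at_right (x n)) \<and>
        (f1 \<longlongrightarrow> snd (snd (r n))) (at_left (x n)) \<and>
        (f \<longlongrightarrow> fst (r n)) (at_right (x n)) \<and> (f \<longlongrightarrow> fst (snd (r n))) (at_left (x n)) \<and>
        fst (r n) - fst (snd (r n)) = complex_of_real (\<beta> n) * snd (snd (r n))" by blast
    then show ?thesis
      by (intro that[of "\<lambda>n. snd (snd (r n))" "\<lambda>n. fst (r n)" "\<lambda>n. fst (snd (r n))"]) blast
  qed
  \<comment> \<open>The domain conditions give one-sided limits of \<open>f\<close> only at the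
    interaction points. At 0 the limit comes from the one-sided differentiability of
    \<open>f\<close>, as 0 is not one of them.\<close>
  have "0 \<in> I - X"
  proof -
    have "0 \<notin> X" 
    proof
      assume "0 \<in> X"
      then obtain k where "k \<ge> 1" "x k = 0" by auto
      then show False using x0 x_less[of 0 k] by simp
    qed
    then show ?thesis using less_b[of 0] x0 by (auto simp: interval0_def zero_ereal_def)
  qed
  then have "(f has_vector_derivative f1 0) (at 0 within I - X)" using W unfolding W22_def by blast
  then have "(f \<longlongrightarrow> f 0) (at 0 within I - X)"
    using has_vector_derivative_continuous continuous_within by blast
  then have "(f \<longlongrightarrow> f 0) (at 0 within {0<..<x 1})"
    by (rule tendsto_within_subset) (use gap_subset[of 0] x0 in simp)
  then have f0: "(f \<longlongrightarrow> f 0) (at_right 0)"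
  proof -
    have "at 0 within {0<..<x 1} = at_right 0"
      by (rule at_within_nhd[of _ "{..<x 1}"]) (use x_less[of 0 1] x0 in auto)
    then show ?thesis using \<open>(f \<longlongrightarrow> f 0) (at 0 within {0<..<x 1})\<close> by simp
  qed
  \<comment> \<open>The chosen limits are unspecified at index 0, so they are overwritten there by
    the data of the left end point.\<close>
  have "boundary_data f f1 g (fp(0 := f 0)) fm (s(0 := 0)) M"
    unfolding boundary_data_def
  proof (intro conjI allI impI ballI)
    fix t assume "t \<in> I - X" "x M < t"
    show "f t = 0"
    proof (rule ccontr)
      assume "f t \<noteq> 0"
      then have "t \<in> supp_off I X f"
        using \<open>t \<in> I - X\<close> unfolding supp_off_def by (intro subsetD[OF closure_subset]) simp
      then show False using M[of t] \<open>x M < t\<close> by simp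
    qed
  next
    fix n
    show "(f \<longlongrightarrow> (fp(0 := f 0)) n) (at_right (x n))" "(f1 \<longlongrightarrow> (s(0 := 0)) n) (at_right (x n))"
      using f0 f10 x0 lims[of n] by (cases "n = 0"; simp)+
  next
    fix n :: nat assume n: "n \<ge> 1"
    show "(f \<longlongrightarrow> fm n) (at_left (x n))" "(f1 \<longlongrightarrow> (s(0 := 0)) n) (at_left (x n))"
      "(fp(0 := f 0)) n - fm n = complex_of_real (\<beta> n) * (s(0 := 0)) n"
      using lims[OF n] n by simp_all
  qed (use W in auto)
  then show ?thesis by (rule that)
qed

text \<open>A single null set serves all gaps, and on an open gap the derivative relative to
  \<open>I - X\<close> is the ordinary two-sided one.\<close>

lemma W22_negligible:
  assumes "W22 I X f f1 (\<lambda>t. - g t)"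
  obtains N where "negligible N"
    "\<And>n t. t \<in> {x n<..<x (Suc n)} - N \<Longrightarrow> (f1 has_vector_derivative - g t) (at t)"
proof -
  have "AE t in lebesgue_on I. (f1 has_vector_derivative - g t) (at t within I - X)"
    using assms unfolding W22_def by blast
  then have "AE t in lebesgue. t \<in> I \<longrightarrow> (f1 has_vector_derivative - g t) (at t within I - X)"
    by (subst (asm) AE_restrict_space_iff) (auto simp: interval0_lebesgue)
  then obtain N where N: "N \<in> null_sets lebesgue"
    "{t. \<not> (t \<in> I \<longrightarrow> (f1 has_vector_derivative - g t) (at t within I - X))} \<subseteq> N"
    by (auto simp: eventually_ae_filter)
  show ?thesis
  proof (rule that)
    show "negligible N" using N(1) negligible_iff_null_sets by blast
    fix n t assume t: "t \<in> {x n<..<x (Suc n)} - N"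
    then have "t \<in> I" using gap_subset[of n] by auto
    then have "(f1 has_vector_derivative - g t) (at t within I - X)" using N(2) t by auto
    then show "(f1 has_vector_derivative - g t) (at t)" using at_within_gap[of t n] t by auto
  qed
qed

section \<open>Norm and quadratic form of an element of the minimal domain\<close>

context
  fixes f f1 g fp fm s M
  assumes bd: "boundary_data f f1 g fp fm s M"
begin

lemma W22_f: "W22 I X f f1 (\<lambda>t. - g t)"
  and vanish: "\<And>t. t \<in> I - X \<Longrightarrow> x M < t \<Longrightarrow> f t = 0"
  and s0: "s 0 = 0"
  and right_lims: "\<And>n. (f \<longlongrightarrow> fp n) (at_right (x n))" "\<And>n. (f1 \<longlongrightarrow> s n) (at_right (x n))"
  and left_lims: "\<And>n. n \<ge> 1 \<Longrightarrow> (f \<longlongrightarrow> fm n) (at_left (x n))" "\<And>n. n \<ge> 1 \<Longrightarrow> (f1 \<longlongrightarrow> s n) (at_left (x n))"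
  and jump: "\<And>n. n \<ge> 1 \<Longrightarrow> fp n - fm n = complex_of_real (\<beta> n) * s n"
  using bd unfolding boundary_data_def by auto

lemma f_L2: "f \<in> L2 I"
  using W22_f unfolding W22_def by blast

lemma g_L2: "g \<in> L2 I"
proof -
  have "(\<lambda>t. - g t) \<in> L2 I" using W22_f unfolding W22_def by blast
  then have "(\<lambda>t. - (- g t)) \<in> L2 I" unfolding L2_def by (auto intro: borel_measurable_uminus)
  then show ?thesis by simp
qed

lemma regular_gap:
  obtains N where "\<And>n. regular_interval (x n) (x (Suc n)) f f1 g (fp n) (fm (Suc n)) (s n) (s (Suc n)) N"
proof -
  obtain N where N: "negligible N"
    "\<And>n t. t \<in> {x n<..<x (Suc n)} - N \<Longrightarrow> (f1 has_vector_derivative - g t) (at t)"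
    using W22_negligible[OF W22_f] by blast
  have "regular_interval (x n) (x (Suc n)) f f1 g (fp n) (fm (Suc n)) (s n) (s (Suc n)) N" for n
  proof
    fix t assume "x n < t" "t < x (Suc n)"
    then have t: "t \<in> {x n<..<x (Suc n)}" by auto
    then have "(f has_vector_derivative f1 t) (at t within I - X)"
      using W22_f gap_subset[of n] unfolding W22_def by blast
    then show "(f has_vector_derivative f1 t) (at t)" using at_within_gap[OF t] by simp
  next
    fix u v assume "x n < u" "u \<le> v" "v < x (Suc n)"
    then have "{u..v} \<subseteq> I - X" using gap_subset[of n] by (auto simp: subset_iff)
    then show "abs_continuous_on u v f1"
      using W22_f \<open>u \<le> v\<close> unfolding W22_def AC_loc_def by blast
  qed (use N right_lims left_lims in auto)
  then show ?thesis by (rule that)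
qed

lemma norm_identity:
  "(L2_norm I f)\<^sup>2 = (\<Sum>n<M. integral {x n..x (Suc n)} (\<lambda>t. (cmod (f t))\<^sup>2))"
  unfolding L2_norm_sq_integral(2)[OF f_L2 interval0_lebesgue]
  by (rule integral_sum_gaps[OF L2_norm_sq_integral(1)[OF f_L2 interval0_lebesgue]]) (simp add: vanish)

text \<open>This removes the boundary term left at the right end of the form identity, and it lets
  sums of right-hand traces stop before \<open>M\<close>.\<close>

lemma fp_M: "fp M = 0"
proof -
  have "\<forall>\<^sub>F t in at_right (x M). f t = 0"
    using eventually_at_right_real[of "x M" "x (Suc M)"] gap_subset[of M]
    by (auto elim!: eventually_mono intro!: vanish)
  then have "(f \<longlongrightarrow> 0) (at_right (x M))" by (rule tendsto_eventually)
  then show ?thesis using right_lims(1)[of M] tendsto_unique trivial_limit_at_right_real by blast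
qed

text \<open>The Green boundary terms from the two sides of an interaction point share the factor
  \<open>s n\<close>, so they combine to \<open>s n\<close> times the conjugate of the jump, that
  is, to \<open>\<beta> n\<close> times |s n|^2. As \<open>\<beta>\<close> is real, the form is
  real, which is the symmetry of the operator. The second sum includes \<open>M\<close>: the
  function may jump to 0 exactly at \<open>x M\<close>.\<close>

lemma form_identity:
  "L2_inner I g f = complex_of_real ((\<Sum>n<M. integral {x n..x (Suc n)} (\<lambda>t. (cmod (f1 t))\<^sup>2))
     + (\<Sum>n=1..M. \<beta> n * (cmod (s n))\<^sup>2))"
proof -
  obtain N where reg: "\<And>n. regular_interval (x n) (x (Suc n)) f f1 g (fp n) (fm (Suc n)) (s n) (s (Suc n)) N"
    using regular_gap by blast
  have int: "(\<lambda>t. g t * cnj (f t)) integrable_on I"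
    by (rule L2_mult_cnj_integrable_on[OF g_L2 f_L2 interval0_lebesgue])
  have "L2_inner I g f = (\<Sum>n<M. integral {x n..x (Suc n)} (\<lambda>t. g t * cnj (f t)))"
    unfolding L2_mult_cnj_integrable_on(2)[OF g_L2 f_L2 interval0_lebesgue]
    by (rule integral_sum_gaps[OF int]) (simp add: vanish)
  also have "\<dots> = (\<Sum>n<M. complex_of_real (integral {x n..x (Suc n)} (\<lambda>t. (cmod (f1 t))\<^sup>2))
       - s (Suc n) * cnj (fm (Suc n)) + s n * cnj (fp n))"
    by (intro sum.cong refl regular_interval.green[OF reg] integrable_on_subinterval[OF int] Icc_subset)
  \<comment> \<open>The induction runs over the number of gaps and keeps the boundary term at the
    current right end. It starts with nothing because of the Neumann condition
    \<open>s 0 = 0\<close>, and at \<open>M\<close> the term is removed by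
    \<open>fp_M\<close>.\<close>
  also have "\<dots> = complex_of_real ((\<Sum>n<m. integral {x n..x (Suc n)} (\<lambda>t. (cmod (f1 t))\<^sup>2))
     + (\<Sum>n=1..m. \<beta> n * (cmod (s n))\<^sup>2)) - s m * cnj (fp m)" if "m = M" for m
    unfolding that[symmetric]
  proof (induction m)
    case (Suc m)
    have "fp (Suc m) = fm (Suc m) + complex_of_real (\<beta> (Suc m)) * s (Suc m)"
      using jump[of "Suc m"] by (simp add: algebra_simps)
    then have "s (Suc m) * cnj (fp (Suc m)) = s (Suc m) * cnj (fm (Suc m)) + complex_of_real (\<beta> (Suc m) * (cmod (s (Suc m)))\<^sup>2)"
      by (simp only: of_real_mult complex_norm_square complex_cnj_add complex_cnj_mult complex_cnj_complex_of_real)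
        (simp add: algebra_simps)
    then show ?case using Suc by (simp add: algebra_simps)
  qed (simp add: s0)
  finally show ?thesis by (simp add: fp_M)
qed

end

lemma H_min_subset_L2: "H_min b x \<beta> \<subseteq> L2 I \<times> L2 I"
  using H_min_boundary_data f_L2 g_L2 by (metis SigmaI subrelI)

section \<open>The sufficient condition\<close>

lemma lower_semibounded_H_min:
  assumes \<beta>: "\<And>n. n \<ge> 1 \<Longrightarrow> \<beta> n \<noteq> 0" and C: "C > 0" and D: "\<And>n. x (Suc n) - x n \<le> D"
    and bound: "\<And>n. n \<ge> 1 \<Longrightarrow> 1 / \<beta> n \<ge> - C * min (x n - x (n - 1)) (x (Suc n) - x n)"
  shows "lower_semibounded I (H_min b x \<beta>)"
proof -
  have Dpos: "D > 0" using D[of 0] x_less[of 0 1] x0 by simp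
  \<comment> \<open>In \<open>4 * C\<close>, one factor 2 comes from splitting the squared jump into
    two squared traces and the other from adding the bounds for the two traces on each gap. With
    this \<open>\<eta>\<close> the Dirichlet integrals enter with total weight exactly 1; the
    remaining multiple of the squared norm is \<open>- c\<close>.\<close>
  define \<eta> where "\<eta> = 1 / (4 * C * D)"
  have \<eta>: "\<eta> > 0" "4 * C * (D * \<eta>) = 1" using C Dpos by (simp_all add: \<eta>_def)
  define c where "c = - (4 * C * (1 + D / \<eta>))"
  have "L2_inner I g f \<in> \<real> \<and> c * (L2_norm I f)\<^sup>2 \<le> Re (L2_inner I g f)" if fg: "(f, g) \<in> H_min b x \<beta>" for f g
  proof -
    obtain f1 fp fm s M where bd: "boundary_data f f1 g fp fm s M"
      using H_min_boundary_data[OF fg] by blast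
    obtain N where reg: "\<And>n. regular_interval (x n) (x (Suc n)) f f1 g (fp n) (fm (Suc n)) (s n) (s (Suc n)) N"
      using regular_gap[OF bd] by blast
    define A where "A n = integral {x n..x (Suc n)} (\<lambda>t. (cmod (f t))\<^sup>2)" for n
    define E where "E n = integral {x n..x (Suc n)} (\<lambda>t. (cmod (f1 t))\<^sup>2)" for n
    define L where "L n = x (Suc n) - x n" for n
    have L: "L n > 0" "L n \<le> D" for n using D by (auto simp: L_def)
    have A0: "A n \<ge> 0" and E0: "E n \<ge> 0" for n
      unfolding A_def E_def using regular_interval.integrable_sq[OF reg] by (auto intro!: integral_nonneg)
    \<comment> \<open>Replacing the length of each gap by the upper bound \<open>D\<close> makes the
      trace constants uniform in \<open>n\<close>.\<close>
    have mon: "(1 + L n / \<eta>) * A n + L n * \<eta> * E n \<le> (1 + D / \<eta>) * A n + D * \<eta> * E n" for n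
      using L[of n] \<eta> A0[of n] E0[of n]
      by (intro add_mono mult_right_mono) (auto intro!: divide_right_mono)
    have tr: "L n * (cmod (fm (Suc n)))\<^sup>2 + L n * (cmod (fp n))\<^sup>2 \<le> 2 * ((1 + D / \<eta>) * A n + D * \<eta> * E n)" for n
    proof -
      note order_trans[OF regular_interval.trace_right[OF reg \<eta>(1)] mon[of n, unfolded A_def E_def L_def]]
        order_trans[OF regular_interval.trace_left[OF reg \<eta>(1)] mon[of n, unfolded A_def E_def L_def]]
      from add_mono[OF this] show ?thesis unfolding A_def E_def L_def mult_2 .
    qed
    have "- (2 * C) * (L (n - 1) * (cmod (fm n))\<^sup>2 + L n * (cmod (fp n))\<^sup>2) \<le> \<beta> n * (cmod (s n))\<^sup>2" if n: "n \<ge> 1" for n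
    proof -
      have j: "fp n - fm n = complex_of_real (\<beta> n) * s n" using jump[OF bd n] .
      \<comment> \<open>The trace \<open>fm n\<close> belongs to the gap \<open>n - 1\<close> and
        \<open>fp n\<close> to the gap \<open>n\<close>. The minimum is at most either length, so
        each trace can be given the weight of its own gap.\<close>
      define m where "m = min (L (n - 1)) (L n)"
      have m: "m \<ge> 0" "m \<le> L (n - 1)" "m \<le> L n" using L[of n] L[of "n - 1"] by (auto simp: m_def)
      have "\<beta> n * (cmod (s n))\<^sup>2 = 1 / \<beta> n * (cmod (fp n - fm n))\<^sup>2"
      proof -
        have "(cmod (fp n - fm n))\<^sup>2 = (\<beta> n)\<^sup>2 * (cmod (s n))\<^sup>2"
          unfolding j by (simp add: norm_mult power_mult_distrib)
        then show ?thesis using \<beta>[OF n] by (simp add: power2_eq_square)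
      qed
      moreover have "- C * m * (cmod (fp n - fm n))\<^sup>2 \<le> 1 / \<beta> n * (cmod (fp n - fm n))\<^sup>2"
        using bound[OF n] n by (intro mult_right_mono) (auto simp: m_def L_def)
      moreover have "(cmod (fp n - fm n))\<^sup>2 \<le> 2 * (cmod (fm n))\<^sup>2 + 2 * (cmod (fp n))\<^sup>2"
      proof -
        have "(cmod (fp n - fm n))\<^sup>2 \<le> (cmod (fp n) + cmod (fm n))\<^sup>2"
          by (intro power_mono norm_triangle_ineq4) simp
        also have "\<dots> \<le> 2 * (cmod (fm n))\<^sup>2 + 2 * (cmod (fp n))\<^sup>2"
          using sum_squares_bound[of "cmod (fp n)" "cmod (fm n)"] by (simp add: power2_sum)
        finally show ?thesis .
      qed
      then have "m * (cmod (fp n - fm n))\<^sup>2 \<le> m * (2 * (cmod (fm n))\<^sup>2 + 2 * (cmod (fp n))\<^sup>2)"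
        using m by (intro mult_left_mono) auto
      moreover have "m * (2 * (cmod (fm n))\<^sup>2) \<le> L (n - 1) * (2 * (cmod (fm n))\<^sup>2)"
        "m * (2 * (cmod (fp n))\<^sup>2) \<le> L n * (2 * (cmod (fp n))\<^sup>2)"
        using m by (auto intro!: mult_right_mono)
      ultimately have "m * (cmod (fp n - fm n))\<^sup>2 \<le> 2 * (L (n - 1) * (cmod (fm n))\<^sup>2 + L n * (cmod (fp n))\<^sup>2)"
        by (simp add: algebra_simps)
      then have "C * (m * (cmod (fp n - fm n))\<^sup>2) \<le> C * (2 * (L (n - 1) * (cmod (fm n))\<^sup>2 + L n * (cmod (fp n))\<^sup>2))"
        using C by (intro mult_left_mono) auto
      with \<open>\<beta> n * _ = _\<close> \<open>- C * m * _ \<le> _\<close> show ?thesis by (simp add: algebra_simps)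
    qed
    then have "(\<Sum>n=1..M. - (2 * C) * (L (n - 1) * (cmod (fm n))\<^sup>2 + L n * (cmod (fp n))\<^sup>2))
        \<le> (\<Sum>n=1..M. \<beta> n * (cmod (s n))\<^sup>2)"
      by (intro sum_mono) auto
    \<comment> \<open>The sum over interaction points is rearranged into a sum over gaps. Left-hand
      traces are shifted by one index; for right-hand traces the term at 0 is added and the one at
      \<open>M\<close> vanishes.\<close>
    moreover have "(\<Sum>n=1..M. L (n - 1) * (cmod (fm n))\<^sup>2 + L n * (cmod (fp n))\<^sup>2)
      \<le> (\<Sum>n<M. L n * (cmod (fm (Suc n)))\<^sup>2 + L n * (cmod (fp n))\<^sup>2)"
    proof -
      have "(\<Sum>n=1..M. L (n - 1) * (cmod (fm n))\<^sup>2) = (\<Sum>n<M. L n * (cmod (fm (Suc n)))\<^sup>2)"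
        by (simp add: sum.atLeast1_atMost_eq)
      moreover have "(\<Sum>n=1..M. L n * (cmod (fp n))\<^sup>2) \<le> (\<Sum>n\<in>insert M {..<M}. L n * (cmod (fp n))\<^sup>2)"
        using L by (intro sum_mono2) (auto simp: less_imp_le)
      then have "(\<Sum>n=1..M. L n * (cmod (fp n))\<^sup>2) \<le> (\<Sum>n<M. L n * (cmod (fp n))\<^sup>2)"
        by (simp add: fp_M[OF bd])
      ultimately show ?thesis by (simp add: sum.distrib)
    qed
    moreover have "(\<Sum>n<M. L n * (cmod (fm (Suc n)))\<^sup>2 + L n * (cmod (fp n))\<^sup>2)
      \<le> (\<Sum>n<M. 2 * ((1 + D / \<eta>) * A n + D * \<eta> * E n))"
      by (intro sum_mono tr)
    moreover have "\<dots> = 2 * ((1 + D / \<eta>) * (\<Sum>n<M. A n) + D * \<eta> * (\<Sum>n<M. E n))"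
      by (simp add: sum_distrib_left sum.distrib algebra_simps)
    ultimately have "- (2 * C) * (2 * ((1 + D / \<eta>) * (\<Sum>n<M. A n) + D * \<eta> * (\<Sum>n<M. E n)))
       \<le> (\<Sum>n=1..M. \<beta> n * (cmod (s n))\<^sup>2)"
      unfolding sum_distrib_left[symmetric]
      using C by (smt (verit) mult_left_mono mult_minus_left)
    moreover have "- (2 * C) * (2 * ((1 + D / \<eta>) * (\<Sum>n<M. A n) + D * \<eta> * (\<Sum>n<M. E n)))
       = c * (\<Sum>n<M. A n) - (4 * C * (D * \<eta>)) * (\<Sum>n<M. E n)"
      unfolding c_def by (simp add: algebra_simps)
    ultimately have "c * (\<Sum>n<M. A n) \<le> (\<Sum>n<M. E n) + (\<Sum>n=1..M. \<beta> n * (cmod (s n))\<^sup>2)"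
      unfolding \<eta>(2) by linarith
    then show ?thesis
      unfolding form_identity[OF bd] norm_identity[OF bd] A_def E_def by simp
  qed
  then show ?thesis unfolding lower_semibounded_def by blast
qed

end

section \<open>Boundary layers\<close>

text \<open>Only the point 0 needs an argument: with exponent at least 2 the difference quotient
  there is still a positive power of \<open>max 0 h\<close>, which tends to 0 from both
  sides.\<close>

lemma has_real_derivative_max_power:
  "((\<lambda>t. max 0 t ^ Suc (Suc n)) has_real_derivative real (Suc (Suc n)) * max 0 t ^ Suc n) (at t)"
proof (cases t "0 :: real" rule: linorder_cases)
  case less
  have "((\<lambda>t. 0 :: real) has_real_derivative 0) (at t)" by simp
  then have "((\<lambda>t. max 0 t ^ Suc (Suc n)) has_real_derivative 0) (at t)"
    by (rule has_field_derivative_transform_within_open[of _ _ _ "{..<0}"]) (use less in auto)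
  then show ?thesis using less by simp
next
  case greater
  have "((\<lambda>t. t ^ Suc (Suc n)) has_real_derivative real (Suc (Suc n)) * t ^ Suc n) (at t)"
    using DERIV_pow[of "Suc (Suc n)" t UNIV] by simp
  then have "((\<lambda>t. max 0 t ^ Suc (Suc n)) has_real_derivative real (Suc (Suc n)) * t ^ Suc n) (at t)"
    by (rule has_field_derivative_transform_within_open[of _ _ _ "{0<..}"]) (use greater in auto)
  then show ?thesis using greater by simp
next
  case equal
  have "isCont (\<lambda>h. max 0 h ^ Suc n) (0::real)" by (intro continuous_intros)
  then have "((\<lambda>h. max 0 h ^ Suc n) \<longlongrightarrow> 0) (at (0::real))" by (simp add: continuous_at)
  moreover have "\<forall>\<^sub>F h in at (0::real). max 0 h ^ Suc n = (max 0 (0 + h) ^ Suc (Suc n) - max 0 0 ^ Suc (Suc n)) / h"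
    unfolding eventually_at_filter by (rule always_eventually) (auto simp: max_def)
  ultimately have "((\<lambda>h. (max 0 (0 + h) ^ Suc (Suc n) - max 0 0 ^ Suc (Suc n)) / h) \<longlongrightarrow> 0) (at (0::real))"
    by (rule Lim_transform_eventually)
  then show ?thesis using equal by (simp add: DERIV_def)
qed

lemma has_real_derivative_max_power_diff:
  "((\<lambda>t. max 0 (t - c) ^ 2) has_real_derivative 2 * max 0 (t - c)) (at t)"
  "((\<lambda>t. max 0 (t - c) ^ 3) has_real_derivative 3 * max 0 (t - c) ^ 2) (at t)"
  using DERIV_chain2[OF has_real_derivative_max_power[of 0 "t - c"] DERIV_diff[OF DERIV_ident DERIV_const[of c]]]
    DERIV_chain2[OF has_real_derivative_max_power[of 1 "t - c"] DERIV_diff[OF DERIV_ident DERIV_const[of c]]]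
  by (simp_all add: eval_nat_numeral)

text \<open>\<open>ramp e\<close> is a C2 spline that vanishes for \<open>t \<le> 0\<close> and equals \<open>t - e\<close> for
  \<open>t \<ge> 2 * e\<close>; its derivatives are \<open>ramp1\<close> and \<open>ramp2\<close>. On \<open>t \<ge> 0\<close>, \<open>kick e\<close> is a C2 function
  supported in \<open>[0, e]\<close> with value 0 and slope 1 at 0, and of size at most \<open>e\<close>. Cubes and fourth
  powers of positive parts keep the second derivatives continuous.\<close>

definition ramp :: "real \<Rightarrow> real \<Rightarrow> real" where
  "ramp e t = (max 0 t ^ 3 - 2 * max 0 (t - e) ^ 3 + max 0 (t - 2 * e) ^ 3) / (6 * e\<^sup>2)"

definition ramp1 :: "real \<Rightarrow> real \<Rightarrow> real" where
  "ramp1 e t = (max 0 t ^ 2 - 2 * max 0 (t - e) ^ 2 + max 0 (t - 2 * e) ^ 2) / (2 * e\<^sup>2)"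

definition ramp2 :: "real \<Rightarrow> real \<Rightarrow> real" where
  "ramp2 e t = (max 0 t - 2 * max 0 (t - e) + max 0 (t - 2 * e)) / e\<^sup>2"

text \<open>On \<open>[0, e]\<close> one has \<open>t / e = 1 - hat e t\<close>, so the kick below
  is \<open>t * (1 - t / e) ^ 3\<close> there: the factor \<open>t\<close> gives value 0 and slope 1
  at 0, and the triple zero at \<open>e\<close> makes the cut-off C2. For negative \<open>t\<close>
  and positive \<open>e\<close> the value exceeds 1, which is why the bounds are stated for
  \<open>t \<ge> 0\<close>.\<close>

definition hat :: "real \<Rightarrow> real \<Rightarrow> real" where
  "hat e t = max 0 (1 - t / e)"

definition kick :: "real \<Rightarrow> real \<Rightarrow> real" where
  "kick e t = e * (hat e t ^ 3 - hat e t ^ 4)"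

definition kick1 :: "real \<Rightarrow> real \<Rightarrow> real" where
  "kick1 e t = 4 * hat e t ^ 3 - 3 * hat e t ^ 2"

definition kick2 :: "real \<Rightarrow> real \<Rightarrow> real" where
  "kick2 e t = (6 * hat e t - 12 * hat e t ^ 2) / e"

lemma hat_power_deriv:
  "((\<lambda>t. hat e t ^ Suc (Suc n)) has_real_derivative - (real (Suc (Suc n)) * hat e t ^ Suc n / e)) (at t)"
proof -
  have "((\<lambda>t. 1 - t / e) has_real_derivative - (1 / e)) (at t)"
    using DERIV_diff[OF DERIV_const[of 1] DERIV_cdivide[OF DERIV_ident, of e]] by simp
  from DERIV_chain2[OF has_real_derivative_max_power this] show ?thesis
    by (simp add: hat_def)
qed

lemma ramp_deriv:
  assumes "e > 0" shows "(ramp e has_real_derivative ramp1 e t) (at t)"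
proof -
  note c = has_real_derivative_max_power_diff(2)
  have "(ramp e has_real_derivative (3 * max 0 (t - 0) ^ 2 - 2 * (3 * max 0 (t - e) ^ 2) + 3 * max 0 (t - 2 * e) ^ 2) / (6 * e\<^sup>2)) (at t)"
  proof -
    have *: "ramp e = (\<lambda>t. (max 0 (t - 0) ^ 3 - 2 * max 0 (t - e) ^ 3 + max 0 (t - 2 * e) ^ 3) / (6 * e\<^sup>2))"
      by (simp add: fun_eq_iff ramp_def)
    show ?thesis unfolding * by (intro DERIV_cdivide DERIV_add DERIV_diff DERIV_cmult c)
  qed
  moreover have "(3 * max 0 (t - 0) ^ 2 - 2 * (3 * max 0 (t - e) ^ 2) + 3 * max 0 (t - 2 * e) ^ 2) / (6 * e\<^sup>2) = ramp1 e t"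
    using assms by (simp add: ramp1_def field_simps)
  ultimately show ?thesis by simp
qed

lemma ramp1_deriv:
  assumes "e > 0" shows "(ramp1 e has_real_derivative ramp2 e t) (at t)"
proof -
  note c = has_real_derivative_max_power_diff(1)
  have "(ramp1 e has_real_derivative (2 * max 0 (t - 0) - 2 * (2 * max 0 (t - e)) + 2 * max 0 (t - 2 * e)) / (2 * e\<^sup>2)) (at t)"
  proof -
    have *: "ramp1 e = (\<lambda>t. (max 0 (t - 0) ^ 2 - 2 * max 0 (t - e) ^ 2 + max 0 (t - 2 * e) ^ 2) / (2 * e\<^sup>2))"
      by (simp add: fun_eq_iff ramp1_def)
    show ?thesis unfolding * by (intro DERIV_cdivide DERIV_add DERIV_diff DERIV_cmult c)
  qed
  moreover have "(2 * max 0 (t - 0) - 2 * (2 * max 0 (t - e)) + 2 * max 0 (t - 2 * e)) / (2 * e\<^sup>2) = ramp2 e t"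
    using assms by (simp add: ramp2_def field_simps)
  ultimately show ?thesis by simp
qed

lemma kick_deriv:
  assumes "e > 0" shows "(kick e has_real_derivative kick1 e t) (at t)"
proof -
  have "(kick e has_real_derivative e * (- (3 * hat e t ^ 2 / e) - - (4 * hat e t ^ 3 / e))) (at t)"
    unfolding kick_def[abs_def]
    using DERIV_cmult[OF DERIV_diff[OF hat_power_deriv[of e 1 t] hat_power_deriv[of e 2 t]], of e]
    by (simp add: eval_nat_numeral)
  moreover have "e * (- (3 * hat e t ^ 2 / e) - - (4 * hat e t ^ 3 / e)) = kick1 e t"
    using assms by (simp add: kick1_def field_simps)
  ultimately show ?thesis by simp
qed

lemma kick1_deriv:
  assumes "e > 0" shows "(kick1 e has_real_derivative kick2 e t) (at t)"
proof -
  have "(kick1 e has_real_derivative 4 * (- (3 * hat e t ^ 2 / e)) - 3 * (- (2 * hat e t / e))) (at t)"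
    unfolding kick1_def[abs_def]
    using DERIV_diff[OF DERIV_cmult[OF hat_power_deriv[of e 1 t], of 4] DERIV_cmult[OF hat_power_deriv[of e 0 t], of 3]]
    by (simp add: eval_nat_numeral)
  moreover have "4 * (- (3 * hat e t ^ 2 / e)) - 3 * (- (2 * hat e t / e)) = kick2 e t"
    using assms by (simp add: kick2_def field_simps)
  ultimately show ?thesis by simp
qed

lemma continuous_ramp2: "continuous_on UNIV (ramp2 e)" and continuous_kick2: "continuous_on UNIV (kick2 e)"
  and continuous_hat: "continuous_on UNIV (hat e)"
  unfolding ramp2_def[abs_def] kick2_def[abs_def] hat_def[abs_def] divide_inverse
  by (intro continuous_intros)+

lemma ramp_le0: "e > 0 \<Longrightarrow> t \<le> 0 \<Longrightarrow> ramp e t = 0 \<and> ramp1 e t = 0 \<and> ramp2 e t = 0"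
  by (simp add: ramp_def ramp1_def ramp2_def max_def)

lemma kick_ge: "e > 0 \<Longrightarrow> t \<ge> e \<Longrightarrow> kick e t = 0 \<and> kick1 e t = 0 \<and> kick2 e t = 0"
  by (simp add: kick_def kick1_def kick2_def hat_def max_def)

lemma kick_0: "kick e 0 = 0" "kick1 e 0 = 1"
  by (simp_all add: kick_def kick1_def hat_def)

lemma ramp_ge:
  assumes "e > 0" "t \<ge> 2 * e"
  shows "ramp e t = t - e" "ramp1 e t = 1"
  using assms by (simp_all add: ramp_def ramp1_def max_def field_simps power2_eq_square power3_eq_cube)

text \<open>The derivative \<open>ramp2\<close> is a second difference of positive parts, a tent of
  height \<open>1 / e\<close> and mass 1 on \<open>[0, 2 * e]\<close>; hence the slope climbs from 0
  to 1. The case distinction follows the polynomial pieces, the upper one being written as 1 minus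
  the mirrored lower one.\<close>

lemma ramp1_bounds:
  assumes "e > 0" shows "0 \<le> ramp1 e t" "ramp1 e t \<le> 1"
proof -
  consider "t \<le> 0" | "0 < t" "t \<le> e" | "e < t" "t \<le> 2 * e" | "t > 2 * e" by linarith
  then have "0 \<le> ramp1 e t \<and> ramp1 e t \<le> 1"
  proof cases
    case 2
    then have "ramp1 e t = t\<^sup>2 / (2 * e\<^sup>2)" by (simp add: ramp1_def max_def)
    moreover have "t\<^sup>2 \<le> e\<^sup>2" using 2 by (intro power_mono) auto
    then have "t\<^sup>2 \<le> 2 * e\<^sup>2" by (smt (verit) zero_le_power2)
    ultimately show ?thesis using assms by simp
  next
    case 3
    then have "ramp1 e t = 1 - (2 * e - t)\<^sup>2 / (2 * e\<^sup>2)"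
      using assms by (simp add: ramp1_def max_def field_simps power2_eq_square)
    moreover have "(2 * e - t)\<^sup>2 \<le> e\<^sup>2" using 3 by (intro power_mono) auto
    then have "(2 * e - t)\<^sup>2 \<le> 2 * e\<^sup>2" by (smt (verit) zero_le_power2)
    ultimately show ?thesis using assms by simp
  qed (use assms ramp_le0 ramp_ge in auto)
  then show "0 \<le> ramp1 e t" "ramp1 e t \<le> 1" by auto
qed

lemma ramp_bounds:
  assumes "e > 0" "2 * e \<le> L" "t \<le> L"
  shows "0 \<le> ramp e t" "ramp e t \<le> L"
proof -
  have mono: "ramp e u \<le> ramp e v" if "u \<le> v" for u v
    using that by (rule DERIV_nonneg_imp_nondecreasing) (use ramp_deriv ramp1_bounds assms in blast)
  show "ramp e t \<le> L" using mono[OF \<open>t \<le> L\<close>] ramp_ge[of e L] assms by simp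
  show "0 \<le> ramp e t"
    using mono[of 0 t] ramp_le0[of e 0] ramp_le0[of e t] assms by (cases "t \<ge> 0") auto
qed

lemma hat_bounds: "e > 0 \<Longrightarrow> t \<ge> 0 \<Longrightarrow> 0 \<le> hat e t \<and> hat e t \<le> 1"
  by (simp add: hat_def)

text \<open>The slope and its square are both dominated by a multiple of \<open>hat\<close>, so the
  single integral of \<open>hat\<close>, at most \<open>e\<close>, later controls every energy term
  of the layer. The factor 3 stems from |4 m - 3| \<le> 3 for m between 0 and 1.\<close>

lemma kick_bounds:
  assumes "e > 0" "t \<ge> 0"
  shows "\<bar>kick e t\<bar> \<le> e" "\<bar>kick1 e t\<bar> \<le> 3 * hat e t" "(kick1 e t)\<^sup>2 \<le> 9 * hat e t"
proof -
  let ?m = "hat e t"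
  have m: "0 \<le> ?m" "?m \<le> 1" using hat_bounds assms by auto
  have "0 \<le> ?m ^ 3 * (1 - ?m)" "?m ^ 3 * (1 - ?m) \<le> 1 * 1"
    using m by (simp, intro mult_mono) (auto simp: power_le_one)
  moreover have "?m ^ 3 * (1 - ?m) = ?m ^ 3 - ?m ^ 4" by (simp add: algebra_simps power_numeral_reduce)
  ultimately have *: "0 \<le> ?m ^ 3 - ?m ^ 4" "?m ^ 3 - ?m ^ 4 \<le> 1" by auto
  then have "\<bar>kick e t\<bar> = e * (?m ^ 3 - ?m ^ 4)" using assms by (simp add: kick_def)
  also have "\<dots> \<le> e * 1" using * assms by (intro mult_left_mono) auto
  finally show "\<bar>kick e t\<bar> \<le> e" by simp
  have eq: "kick1 e t = ?m * (?m * (4 * ?m - 3))" by (simp add: kick1_def algebra_simps power2_eq_square power3_eq_cube)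
  have "\<bar>?m * (4 * ?m - 3)\<bar> \<le> 1 * 3"
    unfolding abs_mult using m by (intro mult_mono) auto
  then have "?m * \<bar>?m * (4 * ?m - 3)\<bar> \<le> ?m * 3" using m by (intro mult_left_mono) auto
  then show b: "\<bar>kick1 e t\<bar> \<le> 3 * ?m" using m by (simp add: eq abs_mult)
  then have "\<bar>kick1 e t\<bar>\<^sup>2 \<le> (3 * ?m)\<^sup>2" by (intro power_mono) auto
  also have "\<dots> = 9 * (?m * ?m)" by (simp add: power2_eq_square)
  also have "\<dots> \<le> 9 * ?m" using m by (simp add: mult_left_le)
  finally show "(kick1 e t)\<^sup>2 \<le> 9 * ?m" by simp
qed

text \<open>The test profile on an interval of length \<open>L\<close>: essentially linear with slope \<open>A\<close>, and with
  slope \<open>A + B\<close> at the right end, which the kick adjusts at an energy cost of order \<open>e\<close>.\<close>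

definition prof :: "real \<Rightarrow> real \<Rightarrow> real \<Rightarrow> real \<Rightarrow> real \<Rightarrow> real" where
  "prof e A B L t = A * ramp e t - B * kick e (L - t)"

definition prof1 :: "real \<Rightarrow> real \<Rightarrow> real \<Rightarrow> real \<Rightarrow> real \<Rightarrow> real" where
  "prof1 e A B L t = A * ramp1 e t + B * kick1 e (L - t)"

definition prof2 :: "real \<Rightarrow> real \<Rightarrow> real \<Rightarrow> real \<Rightarrow> real \<Rightarrow> real" where
  "prof2 e A B L t = A * ramp2 e t - B * kick2 e (L - t)"

lemma prof_deriv: "e > 0 \<Longrightarrow> (prof e A B L has_real_derivative prof1 e A B L t) (at t)"
  unfolding prof_def[abs_def] prof1_def
  by (auto intro!: derivative_eq_intros ramp_deriv DERIV_chain2[OF kick_deriv])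

lemma prof1_deriv: "e > 0 \<Longrightarrow> (prof1 e A B L has_real_derivative prof2 e A B L t) (at t)"
  unfolding prof1_def[abs_def] prof2_def
  by (auto intro!: derivative_eq_intros ramp1_deriv DERIV_chain2[OF kick1_deriv])

lemma continuous_prof2: "continuous_on UNIV (prof2 e A B L)"
  unfolding prof2_def[abs_def]
  by (intro continuous_intros continuous_ramp2 continuous_on_compose2[OF continuous_kick2]) auto

text \<open>The condition \<open>2 * e \<le> L\<close> leaves room for both corrections: the kick at
  the right end does not reach the left end, and the ramp has attained its full slope at
  \<open>L\<close>.\<close>

lemma prof_le0:
  assumes "e > 0" "2 * e \<le> L" "t \<le> 0"
  shows "prof e A B L t = 0" "prof1 e A B L t = 0" "prof2 e A B L t = 0"
  using ramp_le0[of e t] kick_ge[of e "L - t"] assms by (auto simp: prof_def prof1_def prof2_def)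

lemma prof_end:
  assumes "e > 0" "2 * e \<le> L"
  shows "prof e A B L L = A * (L - e)" "prof1 e A B L L = A + B"
  using ramp_ge[of e L] assms by (auto simp: prof_def prof1_def kick_0)

text \<open>A supremum bound is enough for the norm: computing the integral of the square would only
  improve the constant in the necessary condition.\<close>

lemma prof_sq_bound:
  assumes "e > 0" "2 * e \<le> L" "t \<le> L"
  shows "(prof e A B L t)\<^sup>2 \<le> (\<bar>A\<bar> * L + \<bar>B\<bar> * e)\<^sup>2"
proof -
  have "\<bar>prof e A B L t\<bar> \<le> \<bar>A\<bar> * \<bar>ramp e t\<bar> + \<bar>B\<bar> * \<bar>kick e (L - t)\<bar>"
    unfolding prof_def by (metis abs_mult abs_triangle_ineq4)
  also have "\<dots> \<le> \<bar>A\<bar> * L + \<bar>B\<bar> * e"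
    using ramp_bounds[OF assms] kick_bounds(1)[of e "L - t"] assms
    by (intro add_mono mult_left_mono) auto
  finally have "\<bar>prof e A B L t\<bar>\<^sup>2 \<le> (\<bar>A\<bar> * L + \<bar>B\<bar> * e)\<^sup>2" by (intro power_mono) auto
  then show ?thesis by simp
qed

text \<open>After expanding the square, the ramp part is at most \<open>A\<^sup>2\<close> and the
  other two terms are linear in \<open>hat\<close>. Integration then yields
  \<open>A\<^sup>2 * L\<close> plus a term of order \<open>e\<close>.\<close>

lemma prof1_sq_bound:
  assumes "e > 0" "t \<le> L"
  shows "(prof1 e A B L t)\<^sup>2 \<le> A\<^sup>2 + (6 * \<bar>A\<bar> * \<bar>B\<bar> + 9 * B\<^sup>2) * hat e (L - t)"
proof -
  let ?r = "ramp1 e t" and ?k = "kick1 e (L - t)" and ?m = "hat e (L - t)"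
  have r: "0 \<le> ?r" "?r \<le> 1" using ramp1_bounds assms by auto
  have k: "\<bar>?k\<bar> \<le> 3 * ?m" "?k\<^sup>2 \<le> 9 * ?m" using kick_bounds[of e "L - t"] assms by auto
  have m: "0 \<le> ?m" using hat_bounds[of e "L - t"] assms by auto
  have "(prof1 e A B L t)\<^sup>2 = A\<^sup>2 * ?r\<^sup>2 + 2 * (A * B * (?r * ?k)) + B\<^sup>2 * ?k\<^sup>2"
    by (simp add: prof1_def power2_eq_square algebra_simps)
  also have "A\<^sup>2 * ?r\<^sup>2 \<le> A\<^sup>2 * 1"
    using r by (intro mult_left_mono) (auto simp: power_le_one)
  also have "A * B * (?r * ?k) \<le> \<bar>A\<bar> * \<bar>B\<bar> * (1 * (3 * ?m))"
  proof -
    have "A * B * (?r * ?k) \<le> \<bar>A * B * (?r * ?k)\<bar>" by simp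
    also have "\<dots> = \<bar>A\<bar> * \<bar>B\<bar> * (?r * \<bar>?k\<bar>)" using r by (simp add: abs_mult)
    also have "\<dots> \<le> \<bar>A\<bar> * \<bar>B\<bar> * (1 * (3 * ?m))"
      using r k m by (intro mult_left_mono mult_mono) auto
    finally show ?thesis .
  qed
  also have "B\<^sup>2 * ?k\<^sup>2 \<le> B\<^sup>2 * (9 * ?m)" using k by (intro mult_left_mono) auto
  finally show ?thesis by (simp add: algebra_simps)
qed

lemma integral_hat_left:
  assumes "e > 0" "p \<le> q"
  shows "(\<lambda>t. hat e (q - t)) integrable_on {p..q}" "integral {p..q} (\<lambda>t. hat e (q - t)) \<le> e"
proof -
  have "((\<lambda>t. hat e (q - t)) has_integral e / 2 * hat e (q - q) ^ 2 - e / 2 * hat e (q - p) ^ 2) {p..q}"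
  proof (rule fundamental_theorem_of_calculus[OF assms(2)])
    fix t
    have "((\<lambda>t. hat e (q - t) ^ Suc (Suc 0)) has_real_derivative - (2 * hat e (q - t) / e) * (0 - 1)) (at t)"
      using DERIV_chain2[OF hat_power_deriv[of e 0 "q - t"] DERIV_diff[OF DERIV_const[of q] DERIV_ident]] by simp
    from DERIV_cmult[OF this, of "e / 2"]
    have "((\<lambda>t. e / 2 * hat e (q - t) ^ 2) has_real_derivative hat e (q - t)) (at t)"
      using assms by (simp add: eval_nat_numeral)
    then show "((\<lambda>t. e / 2 * hat e (q - t) ^ 2) has_vector_derivative hat e (q - t)) (at t within {p..q})"
      by (simp add: has_real_derivative_iff_has_vector_derivative has_vector_derivative_at_within)
  qed
  moreover have "e / 2 * hat e (q - q) ^ 2 - e / 2 * hat e (q - p) ^ 2 \<le> e"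
  proof -
    have "0 \<le> e / 2 * hat e (q - p) ^ 2" using assms by simp
    moreover have "e / 2 * hat e (q - q) ^ 2 = e / 2" by (simp add: hat_def)
    ultimately show ?thesis using assms by linarith
  qed
  ultimately show "(\<lambda>t. hat e (q - t)) integrable_on {p..q}" "integral {p..q} (\<lambda>t. hat e (q - t)) \<le> e"
    by (auto simp: integral_unique)
qed

lemma integral_hat_right:
  assumes "e > 0" "q \<le> r"
  shows "(\<lambda>t. hat e (t - q)) integrable_on {q..r}" "integral {q..r} (\<lambda>t. hat e (t - q)) \<le> e"
proof -
  have eq: "(\<lambda>t. hat e (- q - t)) = (\<lambda>t. hat e (- t - q))"
    by (intro ext arg_cong[where f = "hat e"]) simp
  show "(\<lambda>t. hat e (t - q)) integrable_on {q..r}"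
    by (intro integrable_continuous_interval continuous_on_compose2[OF continuous_hat] continuous_intros) auto
  have "integral {- r..- q} (\<lambda>t. hat e (- t - q)) = integral {q..r} (\<lambda>t. hat e (t - q))"
    by (rule Henstock_Kurzweil_Integration.integral_reflect_real[of _ _ "\<lambda>t. hat e (t - q)"])
  then show "integral {q..r} (\<lambda>t. hat e (t - q)) \<le> e"
    using integral_hat_left(2)[of e "-r" "-q"] assms unfolding eq by simp
qed

section \<open>Test functions\<close>

lemma split_L2:
  fixes hl hr :: "real \<Rightarrow> real"
  assumes hl: "continuous_on UNIV hl" and hr: "continuous_on UNIV hr"
    and zl: "\<And>t. t \<le> p \<Longrightarrow> hl t = 0" and zr: "\<And>t. r \<le> t \<Longrightarrow> hr t = 0"
    and I: "S \<in> sets lebesgue"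
  shows "(\<lambda>t. complex_of_real (if t < q then hl t else hr t)) \<in> L2 S"
proof -
  let ?h = "\<lambda>t. if t < q then hl t else hr t"
  have m[measurable]: "hl \<in> borel_measurable borel" "hr \<in> borel_measurable borel"
    using hl hr by (auto intro: borel_measurable_continuous_onI)
  have il: "integrable lborel (\<lambda>t. indicator {p..q} t *\<^sub>R (hl t)\<^sup>2)"
    by (rule borel_integrable_compact) (auto intro!: continuous_intros continuous_on_subset[OF hl])
  have ir: "integrable lborel (\<lambda>t. indicator {q..r} t *\<^sub>R (hr t)\<^sup>2)"
    by (rule borel_integrable_compact) (auto intro!: continuous_intros continuous_on_subset[OF hr])
  have "integrable lborel (\<lambda>t. (?h t)\<^sup>2)"
  proof (rule Bochner_Integration.integrable_bound[OF Bochner_Integration.integrable_add[OF il ir]])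
    show "AE t in lborel. norm ((?h t)\<^sup>2) \<le> norm (indicator {p..q} t *\<^sub>R (hl t)\<^sup>2 + indicator {q..r} t *\<^sub>R (hr t)\<^sup>2)"
      using zl zr by (intro AE_I2) (auto simp: indicator_def not_less not_le less_imp_le)
  qed measurable
  then have "integrable lebesgue (\<lambda>t. (?h t)\<^sup>2)"
    by (subst integrable_completion) auto
  then have "integrable (lebesgue_on S) (\<lambda>t. (?h t)\<^sup>2)"
    using I integrable_mult_indicator[of S lebesgue "\<lambda>t. (?h t)\<^sup>2"]
    by (subst integrable_restrict_space) simp_all
  moreover have "(\<lambda>t. complex_of_real (?h t)) \<in> borel_measurable (lebesgue_on S)"
  proof -
    have "(\<lambda>t. complex_of_real (?h t)) \<in> borel_measurable borel" by measurable
    then have "(\<lambda>t. complex_of_real (?h t)) \<in> borel_measurable lebesgue"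
      by (intro measurable_completion) simp
    then show ?thesis by (rule measurable_restrict_space1)
  qed
  moreover have "(cmod (complex_of_real (?h t)))\<^sup>2 = (?h t)\<^sup>2" for t
    by (simp only: norm_of_real power2_abs)
  ultimately show ?thesis unfolding L2_def by (simp only: mem_Collect_eq)
qed

lemma split_has_vector_derivative:
  fixes hl hr :: "real \<Rightarrow> real"
  assumes "\<And>t. (hl has_real_derivative hl' t) (at t)" "\<And>t. (hr has_real_derivative hr' t) (at t)" "t \<noteq> q"
  shows "((\<lambda>t. complex_of_real (if t < q then hl t else hr t)) has_vector_derivative
      complex_of_real (if t < q then hl' t else hr' t)) (at t)"
proof (cases "t < q")
  case True
  have "((\<lambda>t. complex_of_real (hl t)) has_vector_derivative complex_of_real (hl' t)) (at t)"
    using assms(1) by (intro has_vector_derivative_of_real) (simp add: has_real_derivative_iff_has_vector_derivative)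
  then have "((\<lambda>t. complex_of_real (if t < q then hl t else hr t)) has_vector_derivative complex_of_real (hl' t)) (at t)"
    by (rule has_vector_derivative_transform_within_open[of _ _ _ "{..<q}"]) (use True in auto)
  then show ?thesis by (simp only: True if_True)
next
  case False
  have "((\<lambda>t. complex_of_real (hr t)) has_vector_derivative complex_of_real (hr' t)) (at t)"
    using assms(2) by (intro has_vector_derivative_of_real) (simp add: has_real_derivative_iff_has_vector_derivative)
  then have "((\<lambda>t. complex_of_real (if t < q then hl t else hr t)) has_vector_derivative complex_of_real (hr' t)) (at t)"
    by (rule has_vector_derivative_transform_within_open[of _ _ _ "{q<..}"]) (use False assms(3) in auto)
  then show ?thesis by (simp only: False if_False)
qed

text \<open>An interval that misses the gluing point lies on one side of it, where the glued
  function is one of the two C1 pieces.\<close>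

lemma split_abs_continuous:
  fixes hl hr :: "real \<Rightarrow> real"
  assumes d: "\<And>t. (hl has_real_derivative hl' t) (at t)" "\<And>t. (hr has_real_derivative hr' t) (at t)"
    and c: "continuous_on UNIV hl'" "continuous_on UNIV hr'" and q: "q \<notin> {u..v}"
  shows "abs_continuous_on u v (\<lambda>t. complex_of_real (if t < q then hl t else hr t))"
proof (rule abs_continuous_on_C1)
  fix t assume "t \<in> {u..v}"
  then show "((\<lambda>t. complex_of_real (if t < q then hl t else hr t)) has_vector_derivative
      complex_of_real (if t < q then hl' t else hr' t)) (at t within {u..v})"
    using q by (intro has_vector_derivative_at_within[OF split_has_vector_derivative[OF d]]) auto
next
  have cl: "continuous_on {u..v} (\<lambda>t. complex_of_real (hl' t))" and cr: "continuous_on {u..v} (\<lambda>t. complex_of_real (hr' t))"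
    using c by (auto intro!: continuous_on_of_real continuous_on_subset[of UNIV])
  have "(\<forall>t\<in>{u..v}. t < q) \<or> (\<forall>t\<in>{u..v}. \<not> t < q)"
    using q by (metis atLeastAtMost_iff not_less order.trans less_imp_le)
  then show "continuous_on {u..v} (\<lambda>t. complex_of_real (if t < q then hl' t else hr' t))"
  proof
    assume *: "\<forall>t\<in>{u..v}. t < q"
    show "continuous_on {u..v} (\<lambda>t. complex_of_real (if t < q then hl' t else hr' t))"
      by (rule continuous_on_eq[OF cl]) (use * in simp)
  next
    assume *: "\<forall>t\<in>{u..v}. \<not> t < q"
    show "continuous_on {u..v} (\<lambda>t. complex_of_real (if t < q then hl' t else hr' t))"
      by (rule continuous_on_eq[OF cr]) (use * in simp)
  qed
qed

lemma split_tendsto_left: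
  fixes hl hr :: "real \<Rightarrow> real"
  assumes "continuous_on UNIV hl" "k \<le> q"
  shows "((\<lambda>t. complex_of_real (if t < q then hl t else hr t)) \<longlongrightarrow> complex_of_real (hl k)) (at_left k)"
proof -
  have "isCont hl k" using assms(1) by (simp add: continuous_on_eq_continuous_at)
  then have "((\<lambda>t. complex_of_real (hl t)) \<longlongrightarrow> complex_of_real (hl k)) (at_left k)"
    by (intro tendsto_of_real) (simp add: isCont_def filterlim_at_split)
  moreover have "\<forall>\<^sub>F t in at_left k. complex_of_real (hl t) = complex_of_real (if t < q then hl t else hr t)"
    unfolding eventually_at_filter by (rule always_eventually) (use assms(2) in auto)
  ultimately show ?thesis by (rule Lim_transform_eventually)
qed

lemma split_tendsto_right:
  fixes hl hr :: "real \<Rightarrow> real"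
  assumes "continuous_on UNIV hr" "q \<le> k"
  shows "((\<lambda>t. complex_of_real (if t < q then hl t else hr t)) \<longlongrightarrow> complex_of_real (hr k)) (at_right k)"
proof -
  have "isCont hr k" using assms(1) by (simp add: continuous_on_eq_continuous_at)
  then have "((\<lambda>t. complex_of_real (hr t)) \<longlongrightarrow> complex_of_real (hr k)) (at_right k)"
    by (intro tendsto_of_real) (simp add: isCont_def filterlim_at_split)
  moreover have "\<forall>\<^sub>F t in at_right k. complex_of_real (hr t) = complex_of_real (if t < q then hl t else hr t)"
    unfolding eventually_at_filter by (rule always_eventually) (use assms(2) in auto)
  ultimately show ?thesis by (rule Lim_transform_eventually)
qed

lemma split_tendsto_away:
  fixes hl hr :: "real \<Rightarrow> real"
  assumes "continuous_on UNIV hl" "continuous_on UNIV hr" "k \<noteq> q"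
  shows "((\<lambda>t. complex_of_real (if t < q then hl t else hr t)) \<longlongrightarrow>
    complex_of_real (if k < q then hl k else hr k)) (at k)"
proof (cases "k < q")
  case True
  have "isCont hl k" using assms(1) by (simp add: continuous_on_eq_continuous_at)
  then have "((\<lambda>t. complex_of_real (hl t)) \<longlongrightarrow> complex_of_real (hl k)) (at k)"
    by (intro tendsto_of_real) (simp add: isCont_def)
  moreover have "\<forall>\<^sub>F t in at k. complex_of_real (hl t) = complex_of_real (if t < q then hl t else hr t)"
    unfolding eventually_at_topological by (rule exI[of _ "{..<q}"]) (use True in auto)
  ultimately show ?thesis using True by (auto intro: Lim_transform_eventually)
next
  case False
  have "isCont hr k" using assms(2) by (simp add: continuous_on_eq_continuous_at)
  then have "((\<lambda>t. complex_of_real (hr t)) \<longlongrightarrow> complex_of_real (hr k)) (at k)"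
    by (intro tendsto_of_real) (simp add: isCont_def)
  moreover have "\<forall>\<^sub>F t in at k. complex_of_real (hr t) = complex_of_real (if t < q then hl t else hr t)"
    unfolding eventually_at_topological by (rule exI[of _ "{q<..}"]) (use False assms(3) in auto)
  ultimately show ?thesis using False by (auto intro: Lim_transform_eventually)
qed

section \<open>Profiles glued at an interaction point and the necessary condition\<close>

context interaction_points
begin

text \<open>Converse of the extraction of boundary data: it admits explicit functions to the
  operator domain, where the semibound can be evaluated through the form and norm
  identities.\<close>

lemma boundary_data_H_min:
  assumes bd: "boundary_data f f1 g fp fm s M"
  shows "(f, g) \<in> H_min b x \<beta>"
proof -
  let ?S = "supp_off I X f"
  have "{t \<in> I - X. f t \<noteq> 0} \<subseteq> {x 0..x M}"
  proof
    fix t assume "t \<in> {t \<in> I - X. f t \<noteq> 0}"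
    then show "t \<in> {x 0..x M}" using vanish[OF bd, of t] x0 by (force simp: interval0_def)
  qed
  then have S: "?S \<subseteq> {x 0..x M}" unfolding supp_off_def by (intro closure_minimal) auto
  have "compact ?S"
    unfolding compact_eq_bounded_closed
    using bounded_subset[OF bounded_closed_interval S] by (simp add: supp_off_def)
  moreover have "?S \<subseteq> I" using S Icc_subset by blast
  moreover have "(f1 \<longlongrightarrow> 0) (at_right 0)" using right_lims(2)[OF bd, of 0] s0[OF bd] x0 by simp
  ultimately show ?thesis
    unfolding H_min_def using W22_f[OF bd] right_lims[OF bd] left_lims[OF bd] jump[OF bd] by blast
qed

text \<open>Each piece vanishes with its derivatives at the far end of its gap, so the conditions at
  all other interaction points and the Neumann condition at 0 hold trivially. The only genuine
  conditions are the common slope and the jump at \<open>x n\<close>.\<close>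

lemma test_boundary_data:
  fixes hl hr :: "real \<Rightarrow> real"
  assumes n: "n \<ge> 1"
    and dl: "\<And>t. (hl has_real_derivative hl' t) (at t)" "\<And>t. (hl' has_real_derivative hl'' t) (at t)"
    and dr: "\<And>t. (hr has_real_derivative hr' t) (at t)" "\<And>t. (hr' has_real_derivative hr'' t) (at t)"
    and c: "continuous_on UNIV hl''" "continuous_on UNIV hr''"
    and zl: "\<And>t. t \<le> x (n - 1) \<Longrightarrow> hl t = 0 \<and> hl' t = 0 \<and> hl'' t = 0"
    and zr: "\<And>t. x (Suc n) \<le> t \<Longrightarrow> hr t = 0 \<and> hr' t = 0 \<and> hr'' t = 0"
    and sl: "hl' (x n) = s" and sr: "hr' (x n) = s" and j: "hr (x n) - hl (x n) = \<beta> n * s"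
  shows "boundary_data (\<lambda>t. complex_of_real (if t < x n then hl t else hr t))
      (\<lambda>t. complex_of_real (if t < x n then hl' t else hr' t))
      (\<lambda>t. - complex_of_real (if t < x n then hl'' t else hr'' t))
      (\<lambda>k. if k = n then complex_of_real (hr (x n)) else 0)
      (\<lambda>k. if k = n then complex_of_real (hl (x n)) else 0)
      (\<lambda>k. if k = n then complex_of_real s else 0) (Suc n)"
    (is "boundary_data ?f ?f1 ?g ?fp ?fm ?s _")
proof -
  have cont: "continuous_on UNIV hl" "continuous_on UNIV hl'" "continuous_on UNIV hr" "continuous_on UNIV hr'"
    using dl dr by (auto intro!: continuous_at_imp_continuous_on DERIV_isCont)
  have xn: "x n \<in> X" using n by auto
  have off: "t \<noteq> x n" if "t \<in> I - X" for t using that xn by auto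
  have zero: "(if x k < x n then hl (x k) else hr (x k)) = 0 \<and> (if x k < x n then hl' (x k) else hr' (x k)) = 0"
    if "k \<noteq> n" for k
  proof (cases "k < n")
    case True
    then have "x k \<le> x (n - 1)" by simp
    then show ?thesis using zl True by simp
  next
    case False
    then have "x (Suc n) \<le> x k" using that by simp
    then show ?thesis using zr False by simp
  qed
  have lims: "(?f \<longlongrightarrow> 0) (at (x k))" "(?f1 \<longlongrightarrow> 0) (at (x k))" if "k \<noteq> n" for k
  proof -
    have "x k \<noteq> x n" using that x_less by (metis linorder_neqE_nat less_irrefl)
    note split_tendsto_away[OF cont(1,3) this] split_tendsto_away[OF cont(2,4) this]
    then show "(?f \<longlongrightarrow> 0) (at (x k))" "(?f1 \<longlongrightarrow> 0) (at (x k))"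
      using zero[OF that] by (simp_all only: of_real_0)
  qed
  have W: "W22 I X ?f ?f1 (\<lambda>t. - ?g t)"
    unfolding W22_def
  proof (intro conjI ballI)
    show "?f \<in> L2 I"
      by (rule split_L2[OF cont(1,3) _ _ interval0_lebesgue]) (use zl zr in auto)
    have "(\<lambda>t. complex_of_real (if t < x n then hl'' t else hr'' t)) \<in> L2 I"
      by (rule split_L2[OF c _ _ interval0_lebesgue]) (use zl zr in auto)
    then show "(\<lambda>t. - ?g t) \<in> L2 I" by simp
    show "?f \<in> AC_loc (I - X)" "?f1 \<in> AC_loc (I - X)"
      unfolding AC_loc_def using off
      by (auto intro!: split_abs_continuous[OF dl(1) dr(1) cont(2,4)] split_abs_continuous[OF dl(2) dr(2) c])
    have D1: "(?f1 has_vector_derivative - ?g t) (at t within I - X)" if "t \<in> I - X" for t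
      using has_vector_derivative_at_within[OF split_has_vector_derivative[OF dl(2) dr(2) off[OF that]], of "I - X"]
      by (simp only: minus_minus)
    show "(?f has_vector_derivative ?f1 t) (at t within I - X)" if "t \<in> I - X" for t
      by (rule has_vector_derivative_at_within[OF split_has_vector_derivative[OF dl(1) dr(1) off[OF that]]])
    have "AE t in lebesgue. t \<in> I \<longrightarrow> (?f1 has_vector_derivative - ?g t) (at t within I - X)"
    proof (rule AE_I'[of X])
      show "X \<in> null_sets lebesgue" using negligible_X unfolding negligible_iff_null_sets .
      show "{t \<in> space lebesgue. \<not> (t \<in> I \<longrightarrow> (?f1 has_vector_derivative - ?g t) (at t within I - X))} \<subseteq> X"
        using D1 by blast
    qed
    then show "AE t in lebesgue_on I. (?f1 has_vector_derivative - ?g t) (at t within I - X)"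
      by (subst AE_restrict_space_iff) (auto simp: interval0_lebesgue)
  qed
  show ?thesis
    unfolding boundary_data_def
  proof (intro conjI allI impI ballI W)
    fix t assume "t \<in> I - X" "x (Suc n) < t"
    moreover from this have "\<not> t < x n" using x_less[of n "Suc n"] by linarith
    ultimately show "?f t = 0" using zr[of t] by simp
  next
    fix k
    show "(?f \<longlongrightarrow> ?fp k) (at_right (x k))"
      using split_tendsto_right[OF cont(3), of "x n" "x k" hl] lims(1)[of k]
      by (cases "k = n") (simp_all add: filterlim_at_split)
    show "(?f1 \<longlongrightarrow> ?s k) (at_right (x k))"
      using split_tendsto_right[OF cont(4), of "x n" "x k" hl'] lims(2)[of k] sr
      by (cases "k = n") (simp_all add: filterlim_at_split)
  next
    fix k :: nat assume "k \<ge> 1"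
    show "(?f \<longlongrightarrow> ?fm k) (at_left (x k))"
      using split_tendsto_left[OF cont(1), of "x k" "x n" hr] lims(1)[of k]
      by (cases "k = n") (simp_all add: filterlim_at_split)
    show "(?f1 \<longlongrightarrow> ?s k) (at_left (x k))"
      using split_tendsto_left[OF cont(2), of "x k" "x n" hr'] lims(2)[of k] sl
      by (cases "k = n") (simp_all add: filterlim_at_split)
    show "?fp k - ?fm k = complex_of_real (\<beta> k) * ?s k"
      using j by (simp flip: of_real_diff of_real_mult)
  qed (use n in auto)
qed

text \<open>The left piece is a profile starting at \<open>x (n - 1)\<close>, the right one a
  profile reflected at \<open>x (Suc n)\<close>. Reflection reverses the slope, hence the sign in
  \<open>A' + B' = - s\<close>. Since the ramp lags behind the identity by \<open>e\<close>, the end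
  values are \<open>A * (L - e)\<close> and \<open>A' * (L' - e)\<close>, which makes
  \<open>j\<close> the jump condition.\<close>

lemma test_inequality:
  assumes sb: "\<And>f g. (f, g) \<in> H_min b x \<beta> \<Longrightarrow> - K * (L2_norm I f)\<^sup>2 \<le> Re (L2_inner I g f)" and K: "K \<ge> 0"
    and n: "n \<ge> 1" and L: "L = x n - x (n - 1)" and L': "L' = x (Suc n) - x n"
    and e: "e > 0" "2 * e \<le> L" "2 * e \<le> L'"
    and S: "A + B = s" "A' + B' = - s" and j: "A' * (L' - e) - A * (L - e) = \<beta> n * s"
  shows "- K * (L * (\<bar>A\<bar> * L + \<bar>B\<bar> * e)\<^sup>2 + L' * (\<bar>A'\<bar> * L' + \<bar>B'\<bar> * e)\<^sup>2) \<le>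
    (A\<^sup>2 * L + (6 * \<bar>A\<bar> * \<bar>B\<bar> + 9 * B\<^sup>2) * e) + (A'\<^sup>2 * L' + (6 * \<bar>A'\<bar> * \<bar>B'\<bar> + 9 * B'\<^sup>2) * e) + \<beta> n * s\<^sup>2"
proof -
  define p q r where pqr: "p = x (n - 1)" "q = x n" "r = x (Suc n)"
  have lt: "p < q" "q < r" using n by (auto simp: pqr)
  have LL: "L = q - p" "L' = r - q" by (simp_all add: L L' pqr)
  define hl hl' hl'' where h: "hl t = prof e A B L (t - p)" "hl' t = prof1 e A B L (t - p)" "hl'' t = prof2 e A B L (t - p)" for t
  define hr hr' hr'' where h': "hr t = prof e A' B' L' (r - t)" "hr' t = - prof1 e A' B' L' (r - t)" "hr'' t = prof2 e A' B' L' (r - t)" for t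
  have h_fun: "hl = (\<lambda>t. prof e A B L (t - p))" "hl' = (\<lambda>t. prof1 e A B L (t - p))" "hl'' = (\<lambda>t. prof2 e A B L (t - p))"
    "hr = (\<lambda>t. prof e A' B' L' (r - t))" "hr' = (\<lambda>t. - prof1 e A' B' L' (r - t))" "hr'' = (\<lambda>t. prof2 e A' B' L' (r - t))"
    by (auto simp: h h')
  have sh: "((\<lambda>t. t - p) has_real_derivative 1) (at t)" "((\<lambda>t. r - t) has_real_derivative - 1) (at t)" for t
    by (auto intro!: derivative_eq_intros)
  have dl: "(hl has_real_derivative hl' t) (at t)" "(hl' has_real_derivative hl'' t) (at t)" for t
    using DERIV_chain2[OF prof_deriv[OF e(1)] sh(1)] DERIV_chain2[OF prof1_deriv[OF e(1)] sh(1)]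
    unfolding h_fun by simp_all
  have dr: "(hr has_real_derivative hr' t) (at t)" "(hr' has_real_derivative hr'' t) (at t)" for t
    using DERIV_chain2[OF prof_deriv[OF e(1)] sh(2)] DERIV_minus[OF DERIV_chain2[OF prof1_deriv[OF e(1)] sh(2)]]
    unfolding h_fun by simp_all
  have c: "continuous_on UNIV hl''" "continuous_on UNIV hr''"
    unfolding h_fun by (auto intro!: continuous_on_compose2[OF continuous_prof2] continuous_intros)
  have zl: "hl t = 0 \<and> hl' t = 0 \<and> hl'' t = 0" if "t \<le> p" for t
    using prof_le0[OF e(1,2), of "t - p"] that by (simp add: h)
  have zr: "hr t = 0 \<and> hr' t = 0 \<and> hr'' t = 0" if "r \<le> t" for t
    using prof_le0[OF e(1,3), of "r - t"] that by (simp add: h')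
  have ends: "hl' q = s" "hr' q = s" "hr q - hl q = \<beta> n * s"
    using prof_end[OF e(1,2)] prof_end[OF e(1,3)] S j by (simp_all add: h h' flip: LL)
  let ?f = "\<lambda>t. complex_of_real (if t < q then hl t else hr t)"
  let ?f1 = "\<lambda>t. complex_of_real (if t < q then hl' t else hr' t)"
  let ?g = "\<lambda>t. - complex_of_real (if t < q then hl'' t else hr'' t)"
  have bd: "boundary_data ?f ?f1 ?g (\<lambda>k. if k = n then complex_of_real (hr q) else 0)
      (\<lambda>k. if k = n then complex_of_real (hl q) else 0) (\<lambda>k. if k = n then complex_of_real s else 0) (Suc n)"
    using test_boundary_data[OF n dl dr c zl[unfolded pqr] zr[unfolded pqr] ends[unfolded pqr]]
    unfolding pqr .
  define E where "E k = integral {x k..x (Suc k)} (\<lambda>t. (cmod (?f1 t))\<^sup>2)" for k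
  define N where "N k = integral {x k..x (Suc k)} (\<lambda>t. (cmod (?f t))\<^sup>2)" for k
  have low: "E k = 0 \<and> N k = 0" if "k < n - 1" for k
  proof -
    have "?f t = 0 \<and> ?f1 t = 0" if "t \<in> {x k..x (Suc k)}" for t
    proof -
      have "x (Suc k) \<le> p" using \<open>k < n - 1\<close> by (simp add: pqr)
      then have "t \<le> p" "t < q" using that lt by auto
      then show ?thesis using zl[of t] by simp
    qed
    note z = this
    have "E k = integral {x k..x (Suc k)} (\<lambda>t. 0)"
      unfolding E_def by (rule Henstock_Kurzweil_Integration.integral_cong) (simp only: z norm_zero zero_power2)
    moreover have "N k = integral {x k..x (Suc k)} (\<lambda>t. 0)"
      unfolding N_def by (rule Henstock_Kurzweil_Integration.integral_cong) (simp only: z norm_zero zero_power2)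
    ultimately show ?thesis by simp
  qed
  \<comment> \<open>The cut-off \<open>Suc n\<close> counts the gaps 0 to \<open>n\<close>, and the
    test function lives on the last two of them.\<close>
  have sum2: "(\<Sum>k<Suc n. F k) = F (n - 1) + F n" if "\<And>k. k < n - 1 \<Longrightarrow> F k = 0" for F :: "nat \<Rightarrow> real"
  proof -
    obtain m where m: "n = Suc m" using n by (cases n) auto
    then show ?thesis using that by simp
  qed
  have "- K * (N (n - 1) + N n) \<le> E (n - 1) + E n + (\<Sum>k=1..Suc n. \<beta> k * (cmod (if k = n then complex_of_real s else 0))\<^sup>2)"
    using sb[OF boundary_data_H_min[OF bd]] sum2[of E] sum2[of N] low
    unfolding form_identity[OF bd] norm_identity[OF bd] E_def[symmetric] N_def[symmetric]
    by simp
  also have "(\<Sum>k=1..Suc n. \<beta> k * (cmod (if k = n then complex_of_real s else 0))\<^sup>2) = (\<Sum>k=1..Suc n. if k = n then \<beta> n * s\<^sup>2 else 0)"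
    by (rule sum.cong) auto
  also have "\<dots> = \<beta> n * s\<^sup>2" using n by (simp add: sum.delta)
  finally have main: "- K * (N (n - 1) + N n) \<le> E (n - 1) + E n + \<beta> n * s\<^sup>2" .
  have pn: "x (n - 1) = p" "x (Suc (n - 1)) = q" "x n = q" "x (Suc n) = r" using n by (auto simp: pqr)
  \<comment> \<open>At \<open>q\<close> the glued functions take the value of the right piece, so on
    the left gap one point has to be excepted.\<close>
  have eqs: "E (n - 1) = integral {p..q} (\<lambda>t. (hl' t)\<^sup>2)" "N (n - 1) = integral {p..q} (\<lambda>t. (hl t)\<^sup>2)"
    "E n = integral {q..r} (\<lambda>t. (hr' t)\<^sup>2)" "N n = integral {q..r} (\<lambda>t. (hr t)\<^sup>2)"
    unfolding E_def N_def pn by (rule integral_spike[of "{q}"]; auto)+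
  have il: "(\<lambda>t. (hl t)\<^sup>2) integrable_on {p..q}" "(\<lambda>t. (hl' t)\<^sup>2) integrable_on {p..q}"
    "(\<lambda>t. (hr t)\<^sup>2) integrable_on {q..r}" "(\<lambda>t. (hr' t)\<^sup>2) integrable_on {q..r}"
    by (intro integrable_continuous_interval continuous_intros continuous_at_imp_continuous_on ballI
        DERIV_isCont[OF dl(1)] DERIV_isCont[OF dl(2)] DERIV_isCont[OF dr(1)] DERIV_isCont[OF dr(2)])+
  let ?c = "6 * \<bar>A\<bar> * \<bar>B\<bar> + 9 * B\<^sup>2" and ?c' = "6 * \<bar>A'\<bar> * \<bar>B'\<bar> + 9 * B'\<^sup>2"
  have E1: "E (n - 1) \<le> A\<^sup>2 * L + ?c * e"
  proof -
    have "E (n - 1) \<le> integral {p..q} (\<lambda>t. A\<^sup>2 + ?c * hat e (q - t))"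
      unfolding eqs
    proof (rule integral_le[OF il(2)])
      show "(\<lambda>t. A\<^sup>2 + ?c * hat e (q - t)) integrable_on {p..q}"
        using integral_hat_left(1)[OF e(1), of p q] lt
        by (intro integrable_add integrable_on_mult_right) auto
      fix t assume "t \<in> {p..q}"
      then show "(hl' t)\<^sup>2 \<le> A\<^sup>2 + ?c * hat e (q - t)"
        using prof1_sq_bound[OF e(1), of "t - p" L A B] LL by (simp add: h)
    qed
    also have "\<dots> = A\<^sup>2 * L + ?c * integral {p..q} (\<lambda>t. hat e (q - t))"
      using integral_hat_left(1)[OF e(1), of p q] lt LL
      by (subst Henstock_Kurzweil_Integration.integral_add) (auto intro!: integrable_on_mult_right)
    also have "\<dots> \<le> A\<^sup>2 * L + ?c * e"
      using integral_hat_left(2)[OF e(1), of p q] lt by (intro add_mono mult_left_mono) auto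
    finally show ?thesis .
  qed
  have E2: "E n \<le> A'\<^sup>2 * L' + ?c' * e"
  proof -
    have "E n \<le> integral {q..r} (\<lambda>t. A'\<^sup>2 + ?c' * hat e (t - q))"
      unfolding eqs
    proof (rule integral_le[OF il(4)])
      show "(\<lambda>t. A'\<^sup>2 + ?c' * hat e (t - q)) integrable_on {q..r}"
        using integral_hat_right(1)[OF e(1), of q r] lt
        by (intro integrable_add integrable_on_mult_right) auto
      fix t assume "t \<in> {q..r}"
      then show "(hr' t)\<^sup>2 \<le> A'\<^sup>2 + ?c' * hat e (t - q)"
        using prof1_sq_bound[OF e(1), of "r - t" L' A' B'] LL by (simp add: h')
    qed
    also have "\<dots> = A'\<^sup>2 * L' + ?c' * integral {q..r} (\<lambda>t. hat e (t - q))"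
      using integral_hat_right(1)[OF e(1), of q r] lt LL
      by (subst Henstock_Kurzweil_Integration.integral_add) (auto intro!: integrable_on_mult_right)
    also have "\<dots> \<le> A'\<^sup>2 * L' + ?c' * e"
      using integral_hat_right(2)[OF e(1), of q r] lt by (intro add_mono mult_left_mono) auto
    finally show ?thesis .
  qed
  have N1: "N (n - 1) \<le> L * (\<bar>A\<bar> * L + \<bar>B\<bar> * e)\<^sup>2"
  proof -
    have "N (n - 1) \<le> integral {p..q} (\<lambda>t. (\<bar>A\<bar> * L + \<bar>B\<bar> * e)\<^sup>2)"
      unfolding eqs
    proof (rule integral_le[OF il(1)])
      fix t assume "t \<in> {p..q}"
      then show "(hl t)\<^sup>2 \<le> (\<bar>A\<bar> * L + \<bar>B\<bar> * e)\<^sup>2"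
        using prof_sq_bound[OF e(1,2), of "t - p" A B] LL by (simp add: h)
    qed auto
    then show ?thesis using lt LL by simp
  qed
  have N2: "N n \<le> L' * (\<bar>A'\<bar> * L' + \<bar>B'\<bar> * e)\<^sup>2"
  proof -
    have "N n \<le> integral {q..r} (\<lambda>t. (\<bar>A'\<bar> * L' + \<bar>B'\<bar> * e)\<^sup>2)"
      unfolding eqs
    proof (rule integral_le[OF il(3)])
      fix t assume "t \<in> {q..r}"
      then show "(hr t)\<^sup>2 \<le> (\<bar>A'\<bar> * L' + \<bar>B'\<bar> * e)\<^sup>2"
        using prof_sq_bound[OF e(1,3), of "r - t" A' B'] LL by (simp add: h')
    qed auto
    then show ?thesis using lt LL by simp
  qed
  have "K * (N (n - 1) + N n) \<le> K * (L * (\<bar>A\<bar> * L + \<bar>B\<bar> * e)\<^sup>2 + L' * (\<bar>A'\<bar> * L' + \<bar>B'\<bar> * e)\<^sup>2)"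
    by (intro mult_left_mono add_mono N1 N2 K)
  then show ?thesis using main E1 E2 unfolding mult_minus_left by linarith
qed

text \<open>For given bulk slopes \<open>A\<close> and \<open>A'\<close>, the jump condition
  determines the common slope \<open>s e\<close>, and the kicks \<open>B e\<close> and
  \<open>B' e\<close> supply the missing slope on either side. All three stay bounded as
  \<open>e\<close> tends to 0, so the layer terms vanish and
  \<open>\<beta> n * (s e)\<^sup>2\<close> tends to the squared jump divided by
  \<open>\<beta> n\<close>.\<close>

lemma limit_inequality:
  assumes sb: "\<And>f g. (f, g) \<in> H_min b x \<beta> \<Longrightarrow> - K * (L2_norm I f)\<^sup>2 \<le> Re (L2_inner I g f)" and K: "K \<ge> 0"
    and n: "n \<ge> 1" and L: "L = x n - x (n - 1)" and L': "L' = x (Suc n) - x n" and \<beta>: "\<beta> n \<noteq> 0"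
  shows "- K * (L * (\<bar>A\<bar> * L)\<^sup>2 + L' * (\<bar>A'\<bar> * L')\<^sup>2) \<le>
    A\<^sup>2 * L + A'\<^sup>2 * L' + (A' * L' - A * L)\<^sup>2 / \<beta> n"
proof -
  have pos: "L > 0" "L' > 0" using n by (simp_all add: L L')
  define s where "s e = (A' * (L' - e) - A * (L - e)) / \<beta> n" for e
  define B where "B e = s e - A" for e
  define B' where "B' e = - s e - A'" for e
  define lhs where "lhs e = - K * (L * (\<bar>A\<bar> * L + \<bar>B e\<bar> * e)\<^sup>2 + L' * (\<bar>A'\<bar> * L' + \<bar>B' e\<bar> * e)\<^sup>2)" for e
  define rhs where "rhs e = (A\<^sup>2 * L + (6 * \<bar>A\<bar> * \<bar>B e\<bar> + 9 * (B e)\<^sup>2) * e) +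
      (A'\<^sup>2 * L' + (6 * \<bar>A'\<bar> * \<bar>B' e\<bar> + 9 * (B' e)\<^sup>2) * e) + \<beta> n * (s e)\<^sup>2" for e
  have "isCont lhs 0" "isCont rhs 0"
    unfolding lhs_def[abs_def] rhs_def[abs_def] B_def B'_def s_def using \<beta>
    by (auto intro!: continuous_intros)
  then have lim: "(lhs \<longlongrightarrow> lhs 0) (at_right 0)" "(rhs \<longlongrightarrow> rhs 0) (at_right 0)"
    by (simp_all add: isCont_def filterlim_at_split)
  have "\<forall>\<^sub>F e in at_right 0. e \<in> {0<..<min L L' / 2}"
    by (rule eventually_at_right_real) (use pos in auto)
  then have "\<forall>\<^sub>F e in at_right 0. lhs e \<le> rhs e"
  proof eventually_elim
    case (elim e)
    then show ?case
      unfolding lhs_def rhs_def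
      by (intro test_inequality[OF sb K n L L']) (use \<beta> in \<open>auto simp: B_def B'_def s_def\<close>)
  qed
  then have "lhs 0 \<le> rhs 0"
    by (rule tendsto_le[OF trivial_limit_at_right_real lim(2,1)])
  then show ?thesis using \<beta> by (simp add: lhs_def rhs_def s_def power2_eq_square)
qed

text \<open>The bulk slopes (1, 0) and (0, 1) concentrate the limit function on one adjacent gap of
  length l, with a jump of modulus l; dividing by l^2 isolates \<open>1 / \<beta> n\<close>. For
  positive \<open>e\<close> the other gap may carry a kick too, since both sides must share the
  slope at \<open>x n\<close>.\<close>

lemma necessary_bound:
  assumes sb: "\<And>f g. (f, g) \<in> H_min b x \<beta> \<Longrightarrow> - K * (L2_norm I f)\<^sup>2 \<le> Re (L2_inner I g f)" and K: "K \<ge> 0"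
    and n: "n \<ge> 1" and L: "L = x n - x (n - 1)" and L': "L' = x (Suc n) - x n" and \<beta>: "\<beta> n \<noteq> 0"
  shows "1 / \<beta> n \<ge> - K * L - 1 / L" "1 / \<beta> n \<ge> - K * L' - 1 / L'"
proof -
  have div: "1 / \<beta> n \<ge> - K * l - 1 / l" if "l > 0" "- K * (l * l\<^sup>2) \<le> l + l\<^sup>2 / \<beta> n" for l
  proof -
    have "- K * (l * l\<^sup>2) / l\<^sup>2 \<le> (l + l\<^sup>2 / \<beta> n) / l\<^sup>2"
      using that by (intro divide_right_mono) auto
    moreover have "- K * (l * l\<^sup>2) / l\<^sup>2 = - K * l" "(l + l\<^sup>2 / \<beta> n) / l\<^sup>2 = 1 / l + 1 / \<beta> n"
      using that(1) \<beta> by (simp_all add: field_simps power2_eq_square)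
    ultimately show ?thesis by linarith
  qed
  have pos: "L > 0" "L' > 0" using n by (simp_all add: L L')
  show "1 / \<beta> n \<ge> - K * L - 1 / L"
    using limit_inequality[OF sb K n L L' \<beta>, of 1 0] pos by (intro div) simp_all
  show "1 / \<beta> n \<ge> - K * L' - 1 / L'"
    using limit_inequality[OF sb K n L L' \<beta>, of 0 1] pos by (intro div) simp_all
qed

end

section \<open>Both implications for the closed operator\<close>

theorem proposition6p15:
  fixes b :: ereal and x d \<beta> :: "nat \<Rightarrow> real"
  assumes "0 < b"
    and "x 0 = 0" and "strict_mono x" and "\<And>n. ereal (x n) < b"
    and "(\<lambda>n. ereal (x n)) \<longlonglongrightarrow> b"
    and d_def: "\<And>n. n \<ge> 1 \<Longrightarrow> d n = x n - x (n - 1)"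
    and "bdd_above (d ` {1..})"
    and "\<And>n. n \<ge> 1 \<Longrightarrow> \<beta> n \<noteq> 0"
  shows "(lower_semibounded (interval0 b) (H_op b x \<beta>) \<longrightarrow>
           (\<exists>C1::real. C1 > 0 \<and>
              (\<forall>n\<ge>1. 1 / \<beta> n \<ge> - C1 * d n - 1 / d n \<and>
                      1 / \<beta> n \<ge> - C1 * d (n + 1) - 1 / d (n + 1)))) \<and>
         ((\<exists>C2::real. C2 > 0 \<and> (\<forall>n\<ge>1. 1 / \<beta> n \<ge> - C2 * min (d n) (d (n + 1)))) \<longrightarrow>
           lower_semibounded (interval0 b) (H_op b x \<beta>))"
proof -
  interpret interaction_points b x \<beta>
    using assms(2-5) by unfold_locales
  have d_Suc: "d (Suc n) = x (Suc n) - x n" for n using d_def[of "Suc n"] by simp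
  show ?thesis
  proof (intro conjI impI)
    assume "lower_semibounded (interval0 b) (H_op b x \<beta>)"
    then obtain c :: real where c: "\<And>f g. (f, g) \<in> H_op b x \<beta> \<Longrightarrow> c * (L2_norm I f)\<^sup>2 \<le> Re (L2_inner I g f)"
      unfolding lower_semibounded_def by blast
    \<comment> \<open>The lower bound \<open>c\<close> may have either sign; it is weakened to
      \<open>- K\<close> with \<open>K\<close> positive, and the same \<open>K\<close> then serves
      as \<open>C1\<close>.\<close>
    define K where "K = \<bar>c\<bar> + 1"
    have K: "K > 0" "K \<ge> 0" by (simp_all add: K_def)
    have sb: "- K * (L2_norm I f)\<^sup>2 \<le> Re (L2_inner I g f)" if "(f, g) \<in> H_min b x \<beta>" for f g
    proof -
      have "(f, g) \<in> H_op b x \<beta>"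
        using that subset_L2_closure[OF H_min_subset_L2] unfolding H_op_def by blast
      then have "c * (L2_norm I f)\<^sup>2 \<le> Re (L2_inner I g f)" by (rule c)
      moreover have "- K * (L2_norm I f)\<^sup>2 \<le> c * (L2_norm I f)\<^sup>2"
        by (intro mult_right_mono) (auto simp: K_def)
      ultimately show ?thesis by linarith
    qed
    show "\<exists>C1::real. C1 > 0 \<and>
              (\<forall>n\<ge>1. 1 / \<beta> n \<ge> - C1 * d n - 1 / d n \<and>
                      1 / \<beta> n \<ge> - C1 * d (n + 1) - 1 / d (n + 1))"
    proof (intro exI[of _ K] conjI allI impI K(1))
      fix n :: nat assume n: "n \<ge> 1"
      show "1 / \<beta> n \<ge> - K * d n - 1 / d n" "1 / \<beta> n \<ge> - K * d (n + 1) - 1 / d (n + 1)"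
        using necessary_bound[OF sb K(2) n d_def[OF n] d_Suc assms(8)[OF n]] by simp_all
    qed
  next
    assume "\<exists>C2::real. C2 > 0 \<and> (\<forall>n\<ge>1. 1 / \<beta> n \<ge> - C2 * min (d n) (d (n + 1)))"
    then obtain C where C: "C > 0" "\<And>n. n \<ge> 1 \<Longrightarrow> 1 / \<beta> n \<ge> - C * min (d n) (d (n + 1))" by blast
    obtain D where D: "\<And>n. n \<ge> 1 \<Longrightarrow> d n \<le> D"
      using assms(7) unfolding bdd_above_def by auto
    have "lower_semibounded I (H_min b x \<beta>)"
    proof (rule lower_semibounded_H_min[OF assms(8) C(1)])
      show "x (Suc n) - x n \<le> D" for n using D[of "Suc n"] d_Suc[of n] by simp
      show "1 / \<beta> n \<ge> - C * min (x n - x (n - 1)) (x (Suc n) - x n)" if "n \<ge> 1" for n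
        using C(2)[OF that] d_def[OF that] d_Suc[of n] by simp
    qed
    then show "lower_semibounded (interval0 b) (H_op b x \<beta>)"
      unfolding H_op_def by (rule lower_semibounded_closure[OF H_min_subset_L2])
  qed
qed

end
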